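(* For a nonnegative integer $s$ let $F_8(s)$ denote the number of $8\times 8$ Franklin squares with magic sum $s$. Then: If $s\equiv 2 \pmod{12}$ and $s\neq 2$, $$F_8(s)=\tfrac{23}{627056640}s^9+\tfrac{23}{17418240}s^8+\tfrac{167}{6531840}s^7+\tfrac{5}{15552}s^6+\tfrac{2419}{933120}s^5+\tfrac{1013}{77760}s^4+\tfrac{701}{22680}s^3-\tfrac{359}{10206}s^2-\tfrac{177967}{816480}s+\tfrac{241}{17496}.$$ If $s\equiv 4\pmod{12}$, $$F_8(s)=\tfrac{23}{627056640}s^9+\tfrac{23}{17418240}s^8+\tfrac{167}{6531840}s^7+\tfrac{5}{15552}s^6+\tfrac{581}{186624}s^5+\tfrac{1823}{77760}s^4+\tfrac{6127}{45360}s^3+\tfrac{10741}{20412}s^2+\tfrac{113443}{102060}s+\tfrac{3211}{2187}.$$ If $s\equiv 6\pmod{12}$, $$F_8(s)=\tfrac{23}{627056640}s^9+\tfrac{23}{17418240}s^8+\tfrac{167}{6531840}s^7+\tfrac{5}{15552}s^6+\tfrac{2419}{933120}s^5+\tfrac{1013}{77760}s^4+\tfrac{701}{22680}s^3-\tfrac{5}{378}s^2-\tfrac{3967}{10080}s-\tfrac{13}{8}.$$ If $s\equiv 8\pmod{12}$, $$F_8(s)=\tfrac{23}{627056640}s^9+\tfrac{23}{17418240}s^8+\tfrac{167}{6531840}s^7+\tfrac{5}{15552}s^6+\tfrac{581}{186624}s^5+\tfrac{1823}{77760}s^4+\tfrac{6127}{45360}s^3+\tfrac{11189}{20412}s^2+\tfrac{167203}{102060}s+\tfrac{5771}{2187}.$$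 If $s\equiv 10\pmod{12}$, $$F_8(s)=\tfrac{23}{627056640}s^9+\tfrac{23}{17418240}s^8+\tfrac{167}{6531840}s^7+\tfrac{5}{15552}s^6+\tfrac{2419}{933120}s^5+\tfrac{1013}{77760}s^4+\tfrac{701}{22680}s^3-\tfrac{583}{10206}s^2-\tfrac{608047}{816480}s-\tfrac{20239}{17496}.$$ If $s\equiv 0\pmod{12}$, $$F_8(s)=\tfrac{23}{627056640}s^9+\tfrac{23}{17418240}s^8+\tfrac{167}{6531840}s^7+\tfrac{5}{15552}s^6+\tfrac{581}{186624}s^5+\tfrac{1823}{77760}s^4+\tfrac{6127}{45360}s^3+\tfrac{431}{756}s^2+\tfrac{1843}{1260}s+1.$$ Otherwise, $F_8(s)=0$.
   Context: An $8\times 8$ Franklin square with magic sum $s$ is an $8\times 8$ matrix $(y_{ij})_{1\le i,j\le 8}$ with nonnegative integer entries (not required to be distinct) such that: (1) every row and every column sums to $s$; (2) every half-row (the first four or the last four entries of a row) and every half-column (the first four or the last four entries of a column) sums to $s/2$; (3) every bent diagonal sums to $s$; (4) every $2\times 2$ subsquare of adjacent cells, including those that wrap around the edges (the square viewed as a torus), sums to $s/2$. The bent diagonals are the following 32 sets of 8 cells (row indices, resp. column indices, taken modulo 8; $k=0,\dots,7$): $\{(k+j,\,j):1\le j\le 4\}\cup\{(k+9-j,\,j): 5\le j\le 8\}$; $\{(k+9-j,\,j):1\le j\le 4\}\cup\{(k+j,\,j): 5\le j\le 8\}$; and the transposes of these sets (obtained by exchanging row and column coordinates). *)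

theory Defs
  imports "HOL-Analysis.Analysis"
begin

text \<open>
  Cells are indexed by the numeral type \<open>8\<close>, the ring of integers modulo 8, so that index
  arithmetic on rows and columns wraps around.  The row (column) written 8 in the usual
  numbering from 1 to 8 is \<open>8 = 0\<close> in this type.  The order on the type is therefore not the
  order of the rows and columns, and the half-lines are given by explicit sets instead of intervals.
\<close>

type_synonym square8 = "nat ^ 8 ^ 8"

lemma UNIV_8: "UNIV = {1, 2, 3, 4, 5, 6, 7, 8 :: 8}"
proof -
  have "card {1, 2, 3, 4, 5, 6, 7, 8 :: 8} = 8"
    by simp
  then show ?thesis
    using card_subset_eq[of UNIV "{1, 2, 3, 4, 5, 6, 7, 8 :: 8}"] by simp
qed

definition halves :: "8 set set" where
  "halves = {{1, 2, 3, 4}, {5, 6, 7, 8}}"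

definition bent_diagonals :: "(8 \<times> 8) set set" where
  "bent_diagonals =
     (let V1 = (\<lambda>k. {(k + j, j) |j. j \<in> {1, 2, 3, 4}} \<union> {(k + 9 - j, j) |j. j \<in> {5, 6, 7, 8}});
          V2 = (\<lambda>k. {(k + 9 - j, j) |j. j \<in> {1, 2, 3, 4}} \<union> {(k + j, j) |j. j \<in> {5, 6, 7, 8}});
          H1 = (\<lambda>k. prod.swap ` V1 k);
          H2 = (\<lambda>k. prod.swap ` V2 k)
      in range V1 \<union> range V2 \<union> range H1 \<union> range H2)"

text \<open>
  The conditions ``sums to \<open>s/2\<close>'' are doubled to avoid the truncating division on natural
  numbers; in particular there is no Franklin square with odd magic sum.
\<close>

definition franklin8 :: "nat \<Rightarrow> square8 \<Rightarrow> bool" where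
  "franklin8 s y \<longleftrightarrow>
     (\<forall>i. (\<Sum>j\<in>UNIV. y $ i $ j) = s) \<and>
     (\<forall>j. (\<Sum>i\<in>UNIV. y $ i $ j) = s) \<and>
     (\<forall>i. \<forall>H\<in>halves. 2 * (\<Sum>j\<in>H. y $ i $ j) = s) \<and>
     (\<forall>j. \<forall>H\<in>halves. 2 * (\<Sum>i\<in>H. y $ i $ j) = s) \<and>
     (\<forall>D\<in>bent_diagonals. (\<Sum>(i, j)\<in>D. y $ i $ j) = s) \<and>
     (\<forall>i j. 2 * (y $ i $ j + y $ i $ (j + 1) + y $ (i + 1) $ j + y $ (i + 1) $ (j + 1)) = s)"

definition F8 :: "nat \<Rightarrow> nat" where
  "F8 s = card {y. franklin8 s y}"

text \<open>The set counted by \<open>F8\<close> is finite, so \<open>card\<close> is the number of Franklin squares.\<close>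

lemma finite_franklin8: "finite {y. franklin8 s y}"
proof -
  let ?B = "{f. \<forall>p::8 \<times> 8. f p \<in> {..s}}"
  have fin: "finite ?B"
    using finite_PiE[of "UNIV :: (8 \<times> 8) set" "\<lambda>_. {..s}"] by (simp add: PiE_UNIV_domain Pi_def)
  have "y \<in> (\<lambda>f. \<chi> i j. f (i, j)) ` ?B" if "franklin8 s y" for y
  proof -
    have "y $ i $ j \<le> s" for i j
      using that member_le_sum[of j UNIV "\<lambda>j. y $ i $ j"] by (simp add: franklin8_def)
    then show ?thesis
      by (intro image_eqI[where x = "\<lambda>p. y $ fst p $ snd p"]) (auto simp: vec_eq_iff)
  qed
  then have "{y. franklin8 s y} \<subseteq> (\<lambda>f. \<chi> i j. f (i, j)) ` ?B"
    by blast
  then show ?thesis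
    using fin finite_imageI finite_subset by blast
qed

end

theory Submission
  imports Defs
begin

text \<open>
  Write \<open>s = 2 h\<close>.  The \<open>2 \<times> 2\<close> condition says that the entries are \<open>h / 4 \<plusminus> (r\<^sub>i + c\<^sub>j)\<close>,
  with the signs of a checkerboard; the remaining conditions say that each of the pairs of lines
  \<open>(1, 3)\<close>, \<open>(5, 7)\<close>, \<open>(2, 4)\<close>, \<open>(6, 8)\<close> has opposite offsets around a common mean.  So a Franklin
  square is given by \<open>p + q = h\<close> and pairs \<open>a, b, c, d\<close> of integers (offsets of the odd and even rows
  and of the odd and even columns): twice an entry is \<open>p \<plusminus> a \<plusminus> c\<close>, \<open>p \<plusminus> b \<plusminus> d\<close>,
  \<open>q \<plusminus> a \<plusminus> d\<close> or \<open>q \<plusminus> b \<plusminus> c\<close>, and it only has to be even and nonnegative.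

  Nonnegativity depends only on the larger absolute value in each pair.  Given those of \<open>a\<close> and \<open>b\<close>,
  the pairs \<open>c\<close> and \<open>d\<close> range over squares of intervals, so their number is a product of two squares,
  and \<open>F\<^sub>8 (2 h)\<close> becomes a sum over \<open>p\<close> and two radii.  By the symmetries \<open>p \<leftrightarrow> q\<close> and
  \<open>a \<leftrightarrow> b\<close> it is a sum over nonnegative solutions of \<open>2 u + 2 v + 2 e + d = h\<close>, which is
  evaluated one variable at a time; only the last summation, in steps of 3, depends on a residue class.
\<close>

section \<open>Evaluation of the sums\<close>

text \<open>Counts the integer pairs of equal parity whose larger absolute value is
  \<open>a\<close>; for positive \<open>a\<close> it is the difference of squares
  \<open>(a + 1)\<^sup>2 - (a - 1)\<^sup>2\<close>.\<close>

definition radius_weight :: "nat \<Rightarrow> nat" where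
  "radius_weight a = (if a = 0 then 1 else 4 * a)"

text \<open>Counts the integers of absolute value \<open>d\<close>.\<close>

definition sign_weight :: "nat \<Rightarrow> nat" where
  "sign_weight d = (if d = 0 then 1 else 2)"

text \<open>In the variables \<open>d, e, u, v\<close> introduced with \<open>slacks\<close>,
  \<open>n\<close> stands for \<open>u + v\<close> and \<open>k\<close> for
  \<open>min d e\<close>.\<close>

definition inner_sum :: "nat \<Rightarrow> nat \<Rightarrow> nat \<Rightarrow> nat" where
  "inner_sum n k e = (\<Sum>v\<le>n. radius_weight v * radius_weight (v + e) * (n - v + 1)\<^sup>2 * (n - v + k + 1)\<^sup>2)"

text \<open>Here \<open>d\<close> stays at the minimum \<open>k\<close>. As \<open>e\<close> has
  coefficient 2, raising it by 2 costs 2 in \<open>u + v\<close>.\<close>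

definition double_step_sum :: "nat \<Rightarrow> nat \<Rightarrow> nat \<Rightarrow> nat" where
  "double_step_sum n k e = (\<Sum>f\<le>n div 2. inner_sum (n - 2 * f) k (e + 2 * f))"

text \<open>Here \<open>e\<close> stays at the minimum \<open>k\<close> and \<open>d\<close> is
  larger. As \<open>d\<close> has coefficient 1, raising it by 2 costs only 1 in
  \<open>u + v\<close>, which is \<open>f\<close>.\<close>

definition single_step_sum :: "nat \<Rightarrow> nat \<Rightarrow> nat" where
  "single_step_sum n k = (\<Sum>f<n. inner_sum f k k)"

text \<open>Contribution of \<open>min d e = k\<close>: the first sum has
  \<open>d = k \<le> e\<close>, the second \<open>e = k < d\<close>.\<close>

definition gap_sum :: "nat \<Rightarrow> nat \<Rightarrow> nat" where
  "gap_sum n k =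
     (\<Sum>f\<le>n div 2. sign_weight k * sign_weight (k + 2 * f) * inner_sum (n - 2 * f) k (k + 2 * f)) +
     (\<Sum>f<n. sign_weight k * sign_weight (k + 2 * (n - f)) * inner_sum f k k)"

text \<open>Raising both \<open>d\<close> and \<open>e\<close> by 2 costs 6 in
  \<open>2 * e + d\<close>, hence 3 in \<open>u + v\<close>.\<close>

definition total_sum :: "nat \<Rightarrow> nat \<Rightarrow> nat" where
  "total_sum n k = (\<Sum>j\<le>n div 3. gap_sum (n - 3 * j) (k + 2 * j))"

text \<open>The following polynomials were found by interpolation.\<close>

definition inner_poly :: "real \<Rightarrow> real \<Rightarrow> real \<Rightarrow> real" where
  "inner_poly n k e =
     (16 * n^7 + 56 * n^6 * k + 56 * n^6 * e + 56 * n^5 * k^2 + 168 * n^5 * k * e + 140 * n^4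
      * k^2 * e + 112 * n^6 + 336 * n^5 * k + 336 * n^5 * e + 280 * n^4 * k^2 + 840 * n^4 * k
      * e + 560 * n^3 * k^2 * e + 336 * n^5 + 840 * n^4 * k + 1120 * n^4 * e + 560 * n^3 * k^2
      + 2240 * n^3 * k * e + 1120 * n^2 * k^2 * e + 560 * n^4 + 1120 * n^3 * k + 2240 * n^3 *
      e + 560 * n^2 * k^2 + 3360 * n^2 * k * e + 1120 * n * k^2 * e + 504 * n^3 + 784 * n^2 *
      k + 2604 * n^2 * e + 224 * n * k^2 + 2632 * n * k * e + 420 * k^2 * e + 168 * n^2 + 224
      * n * k + 1624 * n * e + 840 * k * e - 16 * n + 420 * e) / 105"

definition double_step_poly :: "real \<Rightarrow> real \<Rightarrow> real \<Rightarrow> real" where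
  "double_step_poly n k e =
     (3 * n^8 + 12 * n^7 * k + 8 * n^7 * e + 14 * n^6 * k^2 + 28 * n^6 * k * e + 28 * n^5 *
      k^2 * e + 40 * n^7 + 140 * n^6 * k + 112 * n^6 * e + 140 * n^5 * k^2 + 336 * n^5 * k * e
      + 280 * n^4 * k^2 * e + 224 * n^6 + 672 * n^5 * k + 672 * n^5 * e + 560 * n^4 * k^2 +
      1680 * n^4 * k * e + 1120 * n^3 * k^2 * e + 672 * n^5 + 1680 * n^4 * k + 2240 * n^4 * e
      + 1120 * n^3 * k^2 + 4480 * n^3 * k * e + 2240 * n^2 * k^2 * e + 1127 * n^4 + 2268 * n^3
      * k + 4452 * n^3 * e + 1106 * n^2 * k^2 + 6692 * n^2 * k * e + 2212 * n * k^2 * e + 980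
      * n^3 + 1540 * n^2 * k + 5208 * n^2 * e + 420 * n * k^2 + 5264 * n * k * e + 840 * k^2 *
      e + 326 * n^2 + 408 * n * k + 3268 * n * e + 1680 * k * e - 12 * n + 840 * e) / 210"

definition inner_poly_0 :: "real \<Rightarrow> real" where
  "inner_poly_0 n =
     (16 * n^7 + 112 * n^6 + 336 * n^5 + 665 * n^4 + 924 * n^3 + 798 * n^2 + 404 * n + 105) / 105"

definition single_step_poly :: "real \<Rightarrow> real \<Rightarrow> real" where
  "single_step_poly n k =
     (6 * n^8 + 48 * n^7 * k + 112 * n^6 * k^2 + 84 * n^5 * k^3 + 24 * n^7 + 168 * n^6 * k +
      336 * n^5 * k^2 + 210 * n^4 * k^3 + 28 * n^6 + 336 * n^5 * k + 700 * n^4 * k^2 + 420 *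
      n^3 * k^3 + 420 * n^4 * k + 840 * n^3 * k^2 + 420 * n^2 * k^3 - 56 * n^4 + 252 * n^3 * k
      + 448 * n^2 * k^2 + 126 * n * k^3 - 84 * n^3 + 42 * n^2 * k + 84 * n * k^2 + 22 * n^2 -
      6 * n * k + 60 * n) / 315"

definition single_step_poly_0 :: "real \<Rightarrow> real" where
  "single_step_poly_0 n =
     (12 * n^8 + 48 * n^7 + 56 * n^6 + 126 * n^5 + 203 * n^4 + 42 * n^3 + 44 * n^2 + 99 * n) / 630"

definition gap_poly :: "real \<Rightarrow> real \<Rightarrow> real" where
  "gap_poly n k =
     (42 * n^8 + 312 * n^7 * k + 700 * n^6 * k^2 + 504 * n^5 * k^3 + 336 * n^7 + 2184 * n^6 *
      k + 4200 * n^5 * k^2 + 2520 * n^4 * k^3 + 1456 * n^6 + 9408 * n^5 * k + 16240 * n^4 *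
      k^2 + 8400 * n^3 * k^3 + 4032 * n^5 + 25200 * n^4 * k + 36960 * n^3 * k^2 + 15120 * n^2
      * k^3 + 6538 * n^4 + 41328 * n^3 * k + 48580 * n^2 * k^2 + 13776 * n * k^3 + 5544 * n^3
      + 40656 * n^2 * k + 34440 * n * k^2 + 5040 * k^3 + 2044 * n^2 + 22032 * n * k + 10080 *
      k^2 + 168 * n + 5040 * k) / 315"

definition gap_poly_0 :: "real \<Rightarrow> real" where
  "gap_poly_0 n =
     (21 * n^8 + 120 * n^7 + 392 * n^6 + 1134 * n^5 + 2219 * n^4 + 2730 * n^3 + 2408 * n^2 +
      1371 * n + 315) / 315"

definition total_poly_0 :: "real \<Rightarrow> real \<Rightarrow> real" where
  "total_poly_0 m k =
     (19872 * m^9 + 43497 * m^8 * k + 30132 * m^7 * k^2 + 6804 * m^6 * k^3 + 105543 * m^8 +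
      229716 * m^7 * k + 155358 * m^6 * k^2 + 34020 * m^5 * k^3 + 253656 * m^7 + 541926 * m^6
      * k + 345114 * m^5 * k^2 + 69930 * m^4 * k^3 + 359352 * m^6 + 753732 * m^5 * k + 432810
      * m^4 * k^2 + 75600 * m^3 * k^3 + 316078 * m^5 + 665203 * m^4 * k + 329098 * m^3 * k^2 +
      45066 * m^2 * k^3 + 167657 * m^4 + 369964 * m^3 * k + 147672 * m^2 * k^2 + 13860 * m *
      k^3 + 49834 * m^3 + 124454 * m^2 * k + 34856 * m * k^2 + 1680 * k^3 + 7528 * m^2 + 23348
      * m * k + 3360 * k^2 + 640 * m + 1680 * k) / 105"

definition total_poly_1 :: "real \<Rightarrow> real \<Rightarrow> real" where
  "total_poly_1 m k =
     (19872 * m^9 + 43497 * m^8 * k + 30132 * m^7 * k^2 + 6804 * m^6 * k^3 + 165159 * m^8 +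
      345708 * m^7 * k + 225666 * m^6 * k^2 + 47628 * m^5 * k^3 + 614592 * m^7 + 1213254 * m^6
      * k + 726138 * m^5 * k^2 + 137970 * m^4 * k^3 + 1341396 * m^6 + 2463804 * m^5 * k +
      1305990 * m^4 * k^2 + 211680 * m^3 * k^3 + 1876462 * m^5 + 3160003 * m^4 * k + 1417738 *
      m^3 * k^2 + 181146 * m^2 * k^3 + 1723701 * m^4 + 2605092 * m^3 * k + 924504 * m^2 * k^2
      + 81732 * m * k^3 + 1026978 * m^3 + 1338926 * m^2 * k + 332552 * m * k^2 + 15120 * k^3 +
      378384 * m^2 + 389796 * m * k + 50400 * k^2 + 77456 * m + 48720 * k + 6720) / 105"

definition total_poly_2 :: "real \<Rightarrow> real \<Rightarrow> real" where
  "total_poly_2 m k =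
     (19872 * m^9 + 43497 * m^8 * k + 30132 * m^7 * k^2 + 6804 * m^6 * k^3 + 224775 * m^8 +
      461700 * m^7 * k + 295974 * m^6 * k^2 + 61236 * m^5 * k^3 + 1134504 * m^7 + 2155230 *
      m^6 * k + 1247778 * m^5 * k^2 + 228690 * m^4 * k^3 + 3351096 * m^6 + 5787180 * m^5 * k +
      2931390 * m^4 * k^2 + 453600 * m^3 * k^3 + 6366766 * m^5 + 9774163 * m^4 * k + 4146058 *
      m^3 * k^2 + 503706 * m^2 * k^3 + 8036525 * m^4 + 10614100 * m^3 * k + 3526236 * m^2 *
      k^2 + 296604 * m * k^3 + 6709746 * m^3 + 7219430 * m^2 * k + 1665632 * m * k^2 + 72240 *
      k^3 + 3558004 * m^2 + 2804780 * m * k + 336000 * k^2 + 1083992 * m + 475440 * k + 144480) / 105"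

text \<open>Expanding the square gives a polynomial of degree 6 in \<open>v\<close>. The summands on
  the right are its coefficients times Faulhaber's formulas for the powers 6 down to 1.\<close>

lemma sum_moments:
  fixes e p q :: real
  shows "(\<Sum>v\<le>n. real v * (real v + e) * (real v ^ 2 - p * real v + q) ^ 2) =
    (let x = real n; y = x * (x + 1) in
      y * (2 * x + 1) * (3 * x ^ 4 + 6 * x ^ 3 - 3 * x + 1) / 42
      + (e - 2 * p) * y ^ 2 * (2 * x ^ 2 + 2 * x - 1) / 12
      + (p ^ 2 + 2 * q - 2 * p * e) * y * (2 * x + 1) * (3 * x ^ 2 + 3 * x - 1) / 30
      + (e * (p ^ 2 + 2 * q) - 2 * p * q) * y ^ 2 / 4
      + (q ^ 2 - 2 * p * q * e) * y * (2 * x + 1) / 6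
      + e * q ^ 2 * y / 2)"
proof (induction n)
  case 0
  then show ?case by simp
next
  case (Suc n)
  show ?case
    unfolding sum.atMost_Suc Suc.IH Let_def of_nat_Suc by (simp add: field_simps power_numeral_reduce)
qed

text \<open>Since \<open>radius_weight\<close> is linear only away from 0, the term
  \<open>v = 0\<close> is split off. In the others the two weights give the factor 16, and the
  product of the two bases is the quadratic in \<open>v\<close> that \<open>sum_moments\<close>
  expects.\<close>

lemma inner_sum_split:
  "real (inner_sum n k e) = real (radius_weight e) * (real n + 1)\<^sup>2 * (real n + real k + 1)\<^sup>2 +
    16 * (\<Sum>v\<le>n. real v * (real v + real e) *
      (real v ^ 2 - (2 * real n + real k + 2) * real v + (real n + 1) * (real n + real k + 1)) ^ 2)"
proof -
  define g where "g v = real (radius_weight v * radius_weight (v + e) * (n - v + 1)\<^sup>2 * (n - v + k + 1)\<^sup>2)" for v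
  have "real (inner_sum n k e) = (\<Sum>v\<le>n. g v)"
    by (simp add: inner_sum_def g_def)
  also have "\<dots> = g 0 + (\<Sum>v\<in>{1..n}. g v)"
    by (simp add: atMost_atLeast0 sum.atLeast_Suc_atMost)
  also have "(\<Sum>v\<in>{1..n}. g v) = (\<Sum>v\<in>{1..n}. 16 * (real v * (real v + real e) *
      (real v ^ 2 - (2 * real n + real k + 2) * real v + (real n + 1) * (real n + real k + 1)) ^ 2))"
  proof (rule sum.cong[OF refl])
    fix v assume v: "v \<in> {1..n}"
    have "g v = 4 * real v * (4 * (real v + real e)) * (real n - real v + 1)\<^sup>2 * (real n - real v + real k + 1)\<^sup>2"
      using v by (simp add: g_def radius_weight_def of_nat_diff algebra_simps)
    then show "g v = 16 * (real v * (real v + real e) *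
      (real v ^ 2 - (2 * real n + real k + 2) * real v + (real n + 1) * (real n + real k + 1)) ^ 2)"
      by algebra
  qed
  \<comment> \<open>The summand vanishes at \<open>v = 0\<close>, so the range may start there
    again.\<close>
  also have "\<dots> = 16 * (\<Sum>v\<in>{0..n}. real v * (real v + real e) *
      (real v ^ 2 - (2 * real n + real k + 2) * real v + (real n + 1) * (real n + real k + 1)) ^ 2)"
    by (simp add: sum_distrib_left sum.atLeast_Suc_atMost)
  finally show ?thesis
    by (simp add: atMost_atLeast0 g_def radius_weight_def ac_simps)
qed

text \<open>For positive \<open>e\<close> the split-off weight is \<open>4 * e\<close>. The case
  \<open>e = 0\<close> has a polynomial of its own; in \<open>gap_sum\<close> it occurs only
  together with \<open>k = 0\<close>, because there \<open>k \<le> e\<close>.\<close>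

lemma inner_sum_eq: "0 < e \<Longrightarrow> real (inner_sum n k e) = inner_poly (real n) (real k) (real e)"
  unfolding inner_sum_split sum_moments Let_def inner_poly_def radius_weight_def by simp algebra

lemma inner_sum_0_eq: "real (inner_sum n 0 0) = inner_poly_0 (real n)"
  unfolding inner_sum_split sum_moments Let_def inner_poly_0_def radius_weight_def by simp algebra

lemma double_step_sum_rec: "double_step_sum (n + 2) k e = inner_sum (n + 2) k e + double_step_sum n k (e + 2)"
  unfolding double_step_sum_def by (simp add: sum.atMost_Suc_shift del: sum.atMost_Suc)

lemma double_step_sum_eq: "0 < e \<Longrightarrow> real (double_step_sum n k e) = double_step_poly (real n) (real k) (real e)"
proof (induction n arbitrary: e rule: nat_induct2)
  case 0
  then show ?case by (simp add: double_step_sum_def inner_sum_eq inner_poly_def double_step_poly_def)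
next
  case 1
  then show ?case by (simp add: double_step_sum_def inner_sum_eq inner_poly_def double_step_poly_def)
next
  case (step n)
  have "real (double_step_sum (n + 2) k e) = inner_poly (real n + 2) (real k) (real e) + double_step_poly (real n) (real k) (real e + 2)"
    using step by (simp add: double_step_sum_rec inner_sum_eq del: add_2_eq_Suc')
  also have "\<dots> = double_step_poly (real n + 2) (real k) (real e)"
    unfolding inner_poly_def double_step_poly_def by algebra
  finally show ?case by (simp add: add.commute)
qed

lemma single_step_sum_eq: "0 < k \<Longrightarrow> real (single_step_sum n k) = single_step_poly (real n) (real k)"
proof (induction n)
  case 0
  then show ?case by (simp add: single_step_sum_def single_step_poly_def)
next
  case (Suc n)
  have "real (single_step_sum (Suc n) k) = inner_poly (real n) (real k) (real k) + single_step_poly (real n) (real k)"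
    using Suc by (simp add: single_step_sum_def inner_sum_eq)
  also have "\<dots> = single_step_poly (real n + 1) (real k)"
    unfolding inner_poly_def single_step_poly_def by algebra
  finally show ?case by (simp add: add.commute)
qed

lemma single_step_sum_0_eq: "real (single_step_sum n 0) = single_step_poly_0 (real n)"
proof (induction n)
  case 0
  then show ?case by (simp add: single_step_sum_def single_step_poly_0_def)
next
  case (Suc n)
  have "real (single_step_sum (Suc n) 0) = inner_poly_0 (real n) + single_step_poly_0 (real n)"
    using Suc by (simp add: single_step_sum_def inner_sum_0_eq)
  also have "\<dots> = single_step_poly_0 (real n + 1)"
    unfolding inner_poly_0_def single_step_poly_0_def by algebra
  finally show ?case by (simp add: add.commute)
qed

text \<open>For positive \<open>k\<close> every sign weight is 2, which gives the common factor
  4.\<close>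

lemma gap_sum_eq:
  assumes "0 < k"
  shows "real (gap_sum n k) = gap_poly (real n) (real k)"
proof -
  have "gap_sum n k = 4 * double_step_sum n k k + 4 * single_step_sum n k"
    using assms by (simp add: gap_sum_def double_step_sum_def single_step_sum_def sign_weight_def sum_distrib_left)
  then have "real (gap_sum n k) = 4 * double_step_poly (real n) (real k) (real k) + 4 * single_step_poly (real n) (real k)"
    using assms by (simp add: double_step_sum_eq single_step_sum_eq)
  also have "\<dots> = gap_poly (real n) (real k)"
    unfolding gap_poly_def double_step_poly_def single_step_poly_def by algebra
  finally show ?thesis .
qed

text \<open>For \<open>k = 0\<close> the term \<open>d = e = 0\<close> has sign weight 1. In all
  others exactly one of \<open>d\<close> and \<open>e\<close> is nonzero, so they have weight 2;
  those with \<open>e > 0\<close> form a double-step sum starting at \<open>e = 2\<close>.\<close>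

lemma gap_sum_0_split: "gap_sum n 0 = inner_sum n 0 0 + (if n < 2 then 0 else 2 * double_step_sum (n - 2) 0 2) + 2 * single_step_sum n 0"
proof -
  have *: "(\<Sum>f<n. sign_weight (2 * (n - f)) * inner_sum f 0 0) = 2 * single_step_sum n 0"
    unfolding single_step_sum_def sum_distrib_left by (rule sum.cong) (auto simp: sign_weight_def)
  show ?thesis
  proof (cases "n < 2")
    case True
    then show ?thesis
      using * by (simp add: gap_sum_def sign_weight_def)
  next
    case False
    then obtain m where "n = m + 2"
      by (metis add.commute le_Suc_ex not_less)
    then show ?thesis
      using * by (simp add: gap_sum_def double_step_sum_def sign_weight_def sum.atMost_Suc_shift sum_distrib_left del: sum.atMost_Suc)
  qed
qed

lemma gap_sum_0_eq: "real (gap_sum n 0) = gap_poly_0 (real n)"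
proof (cases "n < 2")
  case True
  then have "n = 0 \<or> n = 1" by auto
  then show ?thesis
    by (auto simp: gap_sum_0_split inner_sum_0_eq single_step_sum_0_eq inner_poly_0_def single_step_poly_0_def gap_poly_0_def)
next
  case False
  then obtain m where n: "n = m + 2"
    by (metis add.commute le_Suc_ex not_less)
  have "real (gap_sum n 0) = inner_poly_0 (real m + 2) + 2 * double_step_poly (real m) 0 2 + 2 * single_step_poly_0 (real m + 2)"
    unfolding n by (simp add: gap_sum_0_split inner_sum_0_eq single_step_sum_0_eq double_step_sum_eq add.commute del: add_2_eq_Suc')
  also have "\<dots> = gap_poly_0 (real m + 2)"
    unfolding inner_poly_0_def double_step_poly_def single_step_poly_0_def gap_poly_0_def by simp algebra
  finally show ?thesis by (simp add: n add.commute)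
qed

section \<open>Summation in steps of 3, by residue class\<close>

lemma total_sum_rec: "total_sum (n + 3) k = gap_sum (n + 3) k + total_sum n (k + 2)"
  unfolding total_sum_def by (simp add: sum.atMost_Suc_shift del: sum.atMost_Suc)

lemma total_sum_eq_0: "0 < k \<Longrightarrow> real (total_sum (3 * m) k) = total_poly_0 (real m) (real k)"
proof (induction m arbitrary: k)
  case 0
  then show ?case by (simp add: total_sum_def gap_sum_eq gap_poly_def total_poly_0_def)
next
  case (Suc m)
  have "real (total_sum (3 * m + 3) k) = gap_poly (3 * real m + 3) (real k) + total_poly_0 (real m) (real k + 2)"
    using Suc unfolding total_sum_rec by (simp add: gap_sum_eq ac_simps del: add_2_eq_Suc')
  also have "\<dots> = total_poly_0 (real m + 1) (real k)"
    unfolding gap_poly_def total_poly_0_def by algebra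
  finally show ?case by (simp add: add.commute)
qed

lemma total_sum_eq_1: "0 < k \<Longrightarrow> real (total_sum (3 * m + 1) k) = total_poly_1 (real m) (real k)"
proof (induction m arbitrary: k)
  case 0
  then show ?case by (simp add: total_sum_def gap_sum_eq gap_poly_def total_poly_1_def)
next
  case (Suc m)
  have "real (total_sum (3 * m + 1 + 3) k) = gap_poly (3 * real m + 4) (real k) + total_poly_1 (real m) (real k + 2)"
    using Suc unfolding total_sum_rec by (simp add: gap_sum_eq ac_simps del: add_2_eq_Suc')
  also have "\<dots> = total_poly_1 (real m + 1) (real k)"
    unfolding gap_poly_def total_poly_1_def by algebra
  finally show ?case by (simp add: add.commute)
qed

lemma total_sum_eq_2: "0 < k \<Longrightarrow> real (total_sum (3 * m + 2) k) = total_poly_2 (real m) (real k)"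
proof (induction m arbitrary: k)
  case 0
  then show ?case by (simp add: total_sum_def gap_sum_eq gap_poly_def total_poly_2_def)
next
  case (Suc m)
  have "real (total_sum (3 * m + 2 + 3) k) = gap_poly (3 * real m + 5) (real k) + total_poly_2 (real m) (real k + 2)"
    using Suc unfolding total_sum_rec by (simp add: gap_sum_eq ac_simps del: add_2_eq_Suc')
  also have "\<dots> = total_poly_2 (real m + 1) (real k)"
    unfolding gap_poly_def total_poly_2_def by algebra
  finally show ?case by (simp add: add.commute)
qed

text \<open>Removing the term \<open>j = 0\<close> leaves a sum with minimum 2, to which the
  formulas for positive \<open>k\<close> apply. For \<open>m = 0\<close> nothing is left, in
  accordance with the vanishing of the three polynomials at \<open>-1\<close>.\<close>

lemma total_sum_0_eq:
  "real (total_sum (3 * m) 0) = gap_poly_0 (3 * real m) + total_poly_0 (real m - 1) 2"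
  "real (total_sum (3 * m + 1) 0) = gap_poly_0 (3 * real m + 1) + total_poly_1 (real m - 1) 2"
  "real (total_sum (3 * m + 2) 0) = gap_poly_0 (3 * real m + 2) + total_poly_2 (real m - 1) 2"
proof -
  have "real (total_sum (3 * m) 0) = gap_poly_0 (3 * real m) + total_poly_0 (real m - 1) 2 \<and>
    real (total_sum (3 * m + 1) 0) = gap_poly_0 (3 * real m + 1) + total_poly_1 (real m - 1) 2 \<and>
    real (total_sum (3 * m + 2) 0) = gap_poly_0 (3 * real m + 2) + total_poly_2 (real m - 1) 2"
  proof (cases m)
    case 0
    then show ?thesis
      by (simp add: total_sum_def gap_sum_0_eq total_poly_0_def total_poly_1_def total_poly_2_def)
  next
    case (Suc l)
    have "total_sum (3 * m) 0 = gap_sum (3 * m) 0 + total_sum (3 * l) 2"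
      and "total_sum (3 * m + 1) 0 = gap_sum (3 * m + 1) 0 + total_sum (3 * l + 1) 2"
      and "total_sum (3 * m + 2) 0 = gap_sum (3 * m + 2) 0 + total_sum (3 * l + 2) 2"
      using total_sum_rec[of "3 * l" 0] total_sum_rec[of "3 * l + 1" 0] total_sum_rec[of "3 * l + 2" 0]
      by (simp_all add: Suc ac_simps numeral_2_eq_2)
    then show ?thesis
      using total_sum_eq_0[of 2 l] total_sum_eq_1[of 2 l] total_sum_eq_2[of 2 l] by (simp add: gap_sum_0_eq Suc)
  qed
  then show "real (total_sum (3 * m) 0) = gap_poly_0 (3 * real m) + total_poly_0 (real m - 1) 2"
    and "real (total_sum (3 * m + 1) 0) = gap_poly_0 (3 * real m + 1) + total_poly_1 (real m - 1) 2"
    and "real (total_sum (3 * m + 2) 0) = gap_poly_0 (3 * real m + 2) + total_poly_2 (real m - 1) 2"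
    by blast+
qed

text \<open>The substituted \<open>s\<close> is \<open>2 * (3 * k + 2 * n)\<close> for
  \<open>k = 1\<close>, that is \<open>4 * n + 6\<close>, with \<open>n = 3 * m + r\<close>.\<close>

lemma total_sum_1_closed:
  "real (total_sum (3 * m) 1) = (let s = 12 * real m + 6 in
      23 / 627056640 * s ^ 9 + 23 / 17418240 * s ^ 8 + 167 / 6531840 * s ^ 7 + 5 / 15552 * s ^ 6
      + 2419 / 933120 * s ^ 5 + 1013 / 77760 * s ^ 4 + 701 / 22680 * s ^ 3
      - 5 / 378 * s ^ 2 - 3967 / 10080 * s - 13 / 8)"
  "real (total_sum (3 * m + 1) 1) = (let s = 12 * real m + 10 in
      23 / 627056640 * s ^ 9 + 23 / 17418240 * s ^ 8 + 167 / 6531840 * s ^ 7 + 5 / 15552 * s ^ 6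
      + 2419 / 933120 * s ^ 5 + 1013 / 77760 * s ^ 4 + 701 / 22680 * s ^ 3
      - 583 / 10206 * s ^ 2 - 608047 / 816480 * s - 20239 / 17496)"
  "real (total_sum (3 * m + 2) 1) = (let s = 12 * real m + 14 in
      23 / 627056640 * s ^ 9 + 23 / 17418240 * s ^ 8 + 167 / 6531840 * s ^ 7 + 5 / 15552 * s ^ 6
      + 2419 / 933120 * s ^ 5 + 1013 / 77760 * s ^ 4 + 701 / 22680 * s ^ 3
      - 359 / 10206 * s ^ 2 - 177967 / 816480 * s + 241 / 17496)"
  unfolding total_sum_eq_0[OF zero_less_one] total_sum_eq_1[OF zero_less_one] total_sum_eq_2[OF zero_less_one]
    of_nat_1 Let_def total_poly_0_def total_poly_1_def total_poly_2_def power_one mult_1_right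
  by algebra+

lemma total_sum_0_closed:
  "real (total_sum (3 * m) 0) = (let s = 12 * real m in
      23 / 627056640 * s ^ 9 + 23 / 17418240 * s ^ 8 + 167 / 6531840 * s ^ 7 + 5 / 15552 * s ^ 6
      + 581 / 186624 * s ^ 5 + 1823 / 77760 * s ^ 4 + 6127 / 45360 * s ^ 3
      + 431 / 756 * s ^ 2 + 1843 / 1260 * s + 1)"
  "real (total_sum (3 * m + 1) 0) = (let s = 12 * real m + 4 in
      23 / 627056640 * s ^ 9 + 23 / 17418240 * s ^ 8 + 167 / 6531840 * s ^ 7 + 5 / 15552 * s ^ 6
      + 581 / 186624 * s ^ 5 + 1823 / 77760 * s ^ 4 + 6127 / 45360 * s ^ 3
      + 10741 / 20412 * s ^ 2 + 113443 / 102060 * s + 3211 / 2187)"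
  "real (total_sum (3 * m + 2) 0) = (let s = 12 * real m + 8 in
      23 / 627056640 * s ^ 9 + 23 / 17418240 * s ^ 8 + 167 / 6531840 * s ^ 7 + 5 / 15552 * s ^ 6
      + 581 / 186624 * s ^ 5 + 1823 / 77760 * s ^ 4 + 6127 / 45360 * s ^ 3
      + 11189 / 20412 * s ^ 2 + 167203 / 102060 * s + 5771 / 2187)"
  unfolding total_sum_0_eq Let_def gap_poly_0_def total_poly_0_def total_poly_1_def total_poly_2_def
  by algebra+

section \<open>Regrouping the sum over the radii\<close>

text \<open>
  For row radii \<open>a, b\<close> and \<open>p + q = h\<close> the variables stand for \<open>d = \<bar>q - p\<bar>\<close>, \<open>e = \<bar>a - b\<bar>\<close>,
  \<open>u = min p q - max a b\<close> and \<open>v = min a b\<close>.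
\<close>

definition slacks :: "nat \<Rightarrow> (nat \<times> nat \<times> nat \<times> nat) set" where
  "slacks h = {(d, e, u, v). even (d + e) \<and> 2 * u + 2 * v + 2 * e + d = h}"

text \<open>The sign weights count the signs of \<open>q - p\<close> and \<open>a - b\<close>. The
  bounds for the column offsets are \<open>u\<close> and \<open>u + min d e\<close> in some order,
  whence the two squares.\<close>

definition slack_weight :: "nat \<times> nat \<times> nat \<times> nat \<Rightarrow> nat" where
  "slack_weight = (\<lambda>(d, e, u, v). sign_weight d * sign_weight e *
     (radius_weight v * radius_weight (v + e) * (u + 1)\<^sup>2 * (u + min d e + 1)\<^sup>2))"

lemma finite_slacks: "finite (slacks h)"
  by (rule finite_subset[of _ "{..h} \<times> {..h} \<times> {..h} \<times> {..h}"]) (auto simp: slacks_def)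

text \<open>Both \<open>d\<close> and \<open>e\<close> have the parity of \<open>k\<close>, so their
  minimum is \<open>k + 2 * j\<close>. Splitting by \<open>d \<le> e\<close> or \<open>e < d\<close>
  yields the two sums in \<open>gap_sum\<close>.\<close>

lemma sum_slacks:
  assumes "k \<le> 1"
  shows "(\<Sum>z\<in>slacks (3 * k + 2 * n). slack_weight z) = total_sum n k"
proof -
  let ?Z = "slacks (3 * k + 2 * n)"
  let ?I1 = "SIGMA j:{..n div 3}. SIGMA f:{..(n - 3 * j) div 2}. {..n - 3 * j - 2 * f}"
  let ?I2 = "SIGMA j:{..n div 3}. SIGMA f:{..<n - 3 * j}. {..f}"
  let ?Z1 = "{(d, e, u, v). (d, e, u, v) \<in> ?Z \<and> d \<le> e}"
  let ?Z2 = "{(d, e, u, v). (d, e, u, v) \<in> ?Z \<and> e < d}"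
  \<comment> \<open>As \<open>k \<le> 1\<close>, it is the least natural number of its parity, so no
    negative \<open>j\<close> is needed.\<close>
  have par: "\<exists>j. x = k + 2 * j" if "even (x + k)" for x
    using assms that by presburger
  have "total_sum n k =
      (\<Sum>j\<le>n div 3. \<Sum>f\<le>(n - 3 * j) div 2. \<Sum>v\<le>n - 3 * j - 2 * f.
        slack_weight (k + 2 * j, k + 2 * j + 2 * f, n - 3 * j - 2 * f - v, v)) +
      (\<Sum>j\<le>n div 3. \<Sum>f<n - 3 * j. \<Sum>v\<le>f.
        slack_weight (k + 2 * j + 2 * (n - 3 * j - f), k + 2 * j, f - v, v))"
    unfolding total_sum_def gap_sum_def inner_sum_def slack_weight_def sum.distrib
    by (simp add: sum_distrib_left ac_simps)
  also have "\<dots> =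
      (\<Sum>(j, f, v)\<in>?I1. slack_weight (k + 2 * j, k + 2 * j + 2 * f, n - 3 * j - 2 * f - v, v)) +
      (\<Sum>(j, f, v)\<in>?I2. slack_weight (k + 2 * j + 2 * (n - 3 * j - f), k + 2 * j, f - v, v))"
    by (simp add: sum.Sigma)
  also have "(\<Sum>(j, f, v)\<in>?I1. slack_weight (k + 2 * j, k + 2 * j + 2 * f, n - 3 * j - 2 * f - v, v)) =
      (\<Sum>z\<in>?Z1. slack_weight z)"
  proof (rule sum.reindex_cong[symmetric])
    let ?g = "\<lambda>(j, f, v). (k + 2 * j, k + 2 * j + 2 * f, n - 3 * j - 2 * f - v, v)"
    show "inj_on ?g ?I1"
      by (auto simp: inj_on_def)
    show "?Z1 = ?g ` ?I1"
    proof (intro equalityI subsetI)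
      fix z assume "z \<in> ?Z1"
      then obtain d e u v where z: "z = (d, e, u, v)" "even (d + e)" "2 * u + 2 * v + 2 * e + d = 3 * k + 2 * n" "d \<le> e"
        by (auto simp: slacks_def)
      obtain j where j: "d = k + 2 * j"
      proof -
        have "even (d + k)" using z(3) by presburger
        then show ?thesis using par that by blast
      qed
      obtain f where f: "e = d + 2 * f"
        using z(2,4) by (metis dvd_def even_add le_add_diff_inverse even_diff_nat)
      have "n = u + v + 2 * f + 3 * j"
        using z(3) j f by linarith
      then show "z \<in> ?g ` ?I1"
        by (intro image_eqI[where x = "(j, f, v)"])
          (auto simp: z(1) j f less_eq_div_iff_mult_less_eq)
    qed (auto simp: slacks_def less_eq_div_iff_mult_less_eq)
  qed auto
  also have "(\<Sum>(j, f, v)\<in>?I2. slack_weight (k + 2 * j + 2 * (n - 3 * j - f), k + 2 * j, f - v, v)) =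
      (\<Sum>z\<in>?Z2. slack_weight z)"
  proof (rule sum.reindex_cong[symmetric])
    let ?g = "\<lambda>(j, f, v). (k + 2 * j + 2 * (n - 3 * j - f), k + 2 * j, f - v, v)"
    show "inj_on ?g ?I2"
      by (auto simp: inj_on_def)
    show "?Z2 = ?g ` ?I2"
    proof (intro equalityI subsetI)
      fix z assume "z \<in> ?Z2"
      then obtain d e u v where z: "z = (d, e, u, v)" "even (d + e)" "2 * u + 2 * v + 2 * e + d = 3 * k + 2 * n" "e < d"
        by (auto simp: slacks_def)
      obtain f where f: "d = e + 2 * f"
        using z(2,4) by (metis dvd_def even_add le_add_diff_inverse even_diff_nat less_imp_le)
      obtain j where j: "e = k + 2 * j"
      proof -
        have "even (e + k)" using z(3) f by presburger
        then show ?thesis using par that by blast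
      qed
      have "n = u + v + f + 3 * j" "0 < f"
        using z(3,4) j f by linarith+
      then show "z \<in> ?g ` ?I2"
        \<comment> \<open>The second coordinate in \<open>?I2\<close> is \<open>u + v\<close>, not
          the local \<open>f\<close>, which is half of \<open>d - e\<close>.\<close>
        by (intro image_eqI[where x = "(j, u + v, v)"])
          (auto simp: z(1) j f less_eq_div_iff_mult_less_eq)
    qed (auto simp: slacks_def less_eq_div_iff_mult_less_eq)
  qed auto
  also have "(\<Sum>z\<in>?Z1. slack_weight z) + (\<Sum>z\<in>?Z2. slack_weight z) = (\<Sum>z\<in>?Z1 \<union> ?Z2. slack_weight z)"
    by (rule sum.union_disjoint[symmetric])
      (auto intro: finite_subset[OF _ finite_slacks])
  also have "?Z1 \<union> ?Z2 = ?Z"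
    by auto
  finally show ?thesis ..
qed

lemma card_abs_eq: "card {x::int. \<bar>x\<bar> = int d} = sign_weight d"
proof -
  have "{x::int. \<bar>x\<bar> = int d} = {int d, - int d}" by auto
  then show ?thesis by (simp add: sign_weight_def)
qed

lemma finite_abs_eq: "finite {x::int. \<bar>x\<bar> = int d}"
  by (rule finite_subset[of _ "{int d, - int d}"]) auto

definition radii :: "nat \<Rightarrow> (nat \<times> nat \<times> nat) set" where
  "radii h = {(p, a, b). p \<le> h \<and> a \<le> min p (h - p) \<and> b \<le> min p (h - p) \<and> even (a + b + h)}"

lemma sum_radii:
  "(\<Sum>(p, a, b)\<in>radii h. radius_weight a * radius_weight b *
      (min (p - a) (h - p - b) + 1)\<^sup>2 * (min (p - b) (h - p - a) + 1)\<^sup>2) =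
    (\<Sum>z\<in>slacks h. slack_weight z)"
proof -
  \<comment> \<open>Attaching the signed differences \<open>x = q - p\<close> and
    \<open>y = a - b\<close> turns the sign weights into a count and makes the correspondence with
    \<open>radii\<close> bijective.\<close>
  let ?R = "SIGMA z:slacks h. {x::int. \<bar>x\<bar> = int (fst z)} \<times> {y::int. \<bar>y\<bar> = int (fst (snd z))}"
  let ?g = "\<lambda>(d::nat, e, u, v). radius_weight v * radius_weight (v + e) * (u + 1)\<^sup>2 * (u + min d e + 1)\<^sup>2"
  have signs: thesis
    if "t \<in> ?R"
      and "\<And>d e u v x y. \<lbrakk>t = ((d, e, u, v), x, y); (d, e, u, v) \<in> slacks h;
        x = int d \<or> x = - int d; y = int e \<or> y = - int e\<rbrakk> \<Longrightarrow> thesis" for t thesis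
  proof -
    obtain d e u v x y where t: "t = ((d, e, u, v), x, y)"
      by (metis prod.exhaust)
    show thesis
      by (rule that(2)[OF t]) (use that(1) in \<open>auto simp: t abs_if split: if_splits\<close>)
  qed
  have "(\<Sum>z\<in>slacks h. slack_weight z) =
      (\<Sum>z\<in>slacks h. \<Sum>xy\<in>{x::int. \<bar>x\<bar> = int (fst z)} \<times> {y::int. \<bar>y\<bar> = int (fst (snd z))}. ?g z)"
    by (intro sum.cong) (auto simp: slack_weight_def card_cartesian_product card_abs_eq)
  also have "\<dots> = (\<Sum>(z, xy)\<in>?R. ?g z)"
    by (rule sum.Sigma) (auto simp: finite_slacks finite_abs_eq)
  also have "\<dots> = (\<Sum>(p, a, b)\<in>radii h. radius_weight a * radius_weight b *
      (min (p - a) (h - p - b) + 1)\<^sup>2 * (min (p - b) (h - p - a) + 1)\<^sup>2)"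
  \<comment> \<open>Here \<open>u + v + e\<close> is \<open>min p q\<close>, exceeded by
    \<open>p\<close> only for negative \<open>x\<close>; the positive and negative parts of
    \<open>y\<close> are added to \<open>v = min a b\<close>.\<close>
  proof (rule sum.reindex_bij_witness[where
        j = "\<lambda>((d, e, u, v), x, y). (u + v + e + nat (- x), v + nat y, v + nat (- y))" and
        i = "\<lambda>(p, a, b). ((nat \<bar>int h - 2 * int p\<bar>, nat \<bar>int a - int b\<bar>,
            min p (h - p) - max a b, min a b), int h - 2 * int p, int a - int b)"], goal_cases)
    case (1 t)
    then show ?case
      by (rule signs) (auto simp: slacks_def)
  next
    case (2 t)
    then show ?case
      by (rule signs) (auto simp: slacks_def radii_def)
  next
    case (3 r)
    obtain p a b where r: "r = (p, a, b)" by (metis prod.exhaust)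
    with 3 have "p \<le> h" "a \<le> p" "a \<le> h - p" "b \<le> p" "b \<le> h - p" "even (a + b + h)"
      by (auto simp: radii_def)
    then show ?case
      by (cases "p \<le> h - p"; cases "a \<le> b") (auto simp: r min_def max_def)
  next
    case (4 r)
    obtain p a b where r: "r = (p, a, b)" by (metis prod.exhaust)
    with 4 have *: "p \<le> h" "a \<le> p" "a \<le> h - p" "b \<le> p" "b \<le> h - p" "even (a + b + h)"
      by (auto simp: radii_def)
    have "even (nat \<bar>int h - 2 * int p\<bar> + nat \<bar>int a - int b\<bar>)"
      using *(6) by (simp add: even_nat_iff)
    with * show ?case
      by (cases "p \<le> h - p"; cases "a \<le> b") (auto simp: r slacks_def min_def max_def)
  next
    case (5 t)
    then show ?case
    proof (rule signs)
      fix d e u v x y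
      assume *: "t = ((d, e, u, v), x, y)" "(d, e, u, v) \<in> slacks h"
        "x = int d \<or> x = - int d" "y = int e \<or> y = - int e"
      then have h: "h = 2 * u + 2 * v + 2 * e + d"
        by (simp add: slacks_def)
      have **: "min u (u + (d + e)) = u" "min (u + (d + e)) u = u"
        "min (u + d) (u + e) = u + min d e" "min (d + u) (e + u) = u + min d e" "min (u + e) (u + d) = u + min d e"
        by linarith+
      show ?thesis
        using *(3,4)
        by (elim disjE) (simp_all add: *(1) h **, simp_all add: ac_simps **)
    qed
  qed
  finally show ?thesis ..
qed

section \<open>Franklin squares as a linear system\<close>

lemma all_8: "(\<forall>i::8. P i) \<longleftrightarrow> P 1 \<and> P 2 \<and> P 3 \<and> P 4 \<and> P 5 \<and> P 6 \<and> P 7 \<and> P 8"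
proof -
  have "(\<forall>i::8. P i) \<longleftrightarrow> (\<forall>i\<in>UNIV. P i)" by simp
  then show ?thesis unfolding UNIV_8 by simp
qed

lemma sum_bent:
  fixes f g :: "8 \<Rightarrow> 8" and F :: "8 \<Rightarrow> 8 \<Rightarrow> 'a::comm_monoid_add"
  defines "D \<equiv> {(f j, j) |j. j \<in> {1, 2, 3, 4}} \<union> {(g j, j) |j. j \<in> {5, 6, 7, 8}}"
  shows "(\<Sum>(i, j)\<in>D. F i j) = F (f 1) 1 + F (f 2) 2 + F (f 3) 3 + F (f 4) 4 +
      F (g 5) 5 + F (g 6) 6 + F (g 7) 7 + F (g 8) 8"
    and "(\<Sum>(i, j)\<in>prod.swap ` D. F i j) = F 1 (f 1) + F 2 (f 2) + F 3 (f 3) + F 4 (f 4) +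
      F 5 (g 5) + F 6 (g 6) + F 7 (g 7) + F 8 (g 8)"
proof -
  have D: "D = {(f 1, 1), (f 2, 2), (f 3, 3), (f 4, 4), (g 5, 5), (g 6, 6), (g 7, 7), (g 8, 8)}"
    unfolding D_def by blast
  show "(\<Sum>(i, j)\<in>D. F i j) = F (f 1) 1 + F (f 2) 2 + F (f 3) 3 + F (f 4) 4 +
      F (g 5) 5 + F (g 6) 6 + F (g 7) 7 + F (g 8) 8"
    unfolding D by (simp add: add.assoc)
  show "(\<Sum>(i, j)\<in>prod.swap ` D. F i j) = F 1 (f 1) + F 2 (f 2) + F 3 (f 3) + F 4 (f 4) +
      F 5 (g 5) + F 6 (g 6) + F 7 (g 7) + F 8 (g 8)"
    unfolding D by (simp add: add.assoc)
qed

text \<open>Here \<open>s\<close> is half the magic sum, and indices are reduced modulo 8. The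
  semiring is arbitrary because the system is used for natural entries and for doubled integer
  entries.\<close>

definition franklin_sums :: "'a::semiring_1 \<Rightarrow> (8 \<Rightarrow> 8 \<Rightarrow> 'a) \<Rightarrow> bool" where
  "franklin_sums s e \<longleftrightarrow>
    (\<forall>i. e i 1 + e i 2 + e i 3 + e i 4 = s \<and> e i 5 + e i 6 + e i 7 + e i 8 = s) \<and>
    (\<forall>j. e 1 j + e 2 j + e 3 j + e 4 j = s \<and> e 5 j + e 6 j + e 7 j + e 8 j = s) \<and>
    (\<forall>k. e (k + 1) 1 + e (k + 2) 2 + e (k + 3) 3 + e (k + 4) 4 +
        e (k + 4) 5 + e (k + 3) 6 + e (k + 2) 7 + e (k + 1) 8 = 2 * s) \<and>
    (\<forall>k. e k 1 + e (k + 7) 2 + e (k + 6) 3 + e (k + 5) 4 +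
        e (k + 5) 5 + e (k + 6) 6 + e (k + 7) 7 + e k 8 = 2 * s) \<and>
    (\<forall>k. e 1 (k + 1) + e 2 (k + 2) + e 3 (k + 3) + e 4 (k + 4) +
        e 5 (k + 4) + e 6 (k + 3) + e 7 (k + 2) + e 8 (k + 1) = 2 * s) \<and>
    (\<forall>k. e 1 k + e 2 (k + 7) + e 3 (k + 6) + e 4 (k + 5) +
        e 5 (k + 5) + e 6 (k + 6) + e 7 (k + 7) + e 8 k = 2 * s) \<and>
    (\<forall>i j. e i j + e i (j + 1) + e (i + 1) j + e (i + 1) (j + 1) = s)"

lemma franklin8_iff_nat: "franklin8 (2 * h) y \<longleftrightarrow> franklin_sums h (\<lambda>i j. y $ i $ j)"
proof -
  let ?e = "\<lambda>i j. y $ i $ j"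
  have ar: "k + 9 - 1 = k" "k + 9 - 2 = k + 7" "k + 9 - 3 = k + 6" "k + 9 - 4 = k + 5"
    "k + 9 - 5 = k + 4" "k + 9 - 6 = k + 3" "k + 9 - 7 = k + 2" "k + 9 - 8 = k + 1"
    "k + 8 = k" for k :: 8
    by (simp_all add: algebra_simps)
  have bent: "(\<forall>D\<in>bent_diagonals. (\<Sum>(i, j)\<in>D. y $ i $ j) = 2 * h) \<longleftrightarrow>
    (\<forall>k. ?e (k + 1) 1 + ?e (k + 2) 2 + ?e (k + 3) 3 + ?e (k + 4) 4 +
        ?e (k + 4) 5 + ?e (k + 3) 6 + ?e (k + 2) 7 + ?e (k + 1) 8 = 2 * h) \<and>
    (\<forall>k. ?e k 1 + ?e (k + 7) 2 + ?e (k + 6) 3 + ?e (k + 5) 4 +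
        ?e (k + 5) 5 + ?e (k + 6) 6 + ?e (k + 7) 7 + ?e k 8 = 2 * h) \<and>
    (\<forall>k. ?e 1 (k + 1) + ?e 2 (k + 2) + ?e 3 (k + 3) + ?e 4 (k + 4) +
        ?e 5 (k + 4) + ?e 6 (k + 3) + ?e 7 (k + 2) + ?e 8 (k + 1) = 2 * h) \<and>
    (\<forall>k. ?e 1 k + ?e 2 (k + 7) + ?e 3 (k + 6) + ?e 4 (k + 5) +
        ?e 5 (k + 5) + ?e 6 (k + 6) + ?e 7 (k + 7) + ?e 8 k = 2 * h)"
    unfolding bent_diagonals_def Let_def ball_Un ball_simps sum_bent
    unfolding ar by blast
  have double: "2 * m = 2 * n \<longleftrightarrow> m = n" for m n :: nat
    by simp
  have half: "(\<forall>H\<in>halves. 2 * (\<Sum>j\<in>H. f j) = 2 * h) \<longleftrightarrow>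
      f 1 + f 2 + f 3 + f 4 = h \<and> f 5 + f 6 + f 7 + f 8 = h" for f :: "8 \<Rightarrow> nat"
    by (auto simp: halves_def)
  have full: "(\<Sum>j\<in>UNIV. f j) = 2 * h" if "\<forall>H\<in>halves. 2 * (\<Sum>j\<in>H. f j) = 2 * h" for f :: "8 \<Rightarrow> nat"
  proof -
    have "(\<Sum>j\<in>UNIV. f j) = f 1 + f 2 + f 3 + f 4 + (f 5 + f 6 + f 7 + f 8)"
      unfolding UNIV_8 by simp
    then show ?thesis
      using that unfolding half by linarith
  qed
  have "franklin8 (2 * h) y \<longleftrightarrow>
     (\<forall>i. \<forall>H\<in>halves. 2 * (\<Sum>j\<in>H. y $ i $ j) = 2 * h) \<and>
     (\<forall>j. \<forall>H\<in>halves. 2 * (\<Sum>i\<in>H. y $ i $ j) = 2 * h) \<and>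
     (\<forall>D\<in>bent_diagonals. (\<Sum>(i, j)\<in>D. y $ i $ j) = 2 * h) \<and>
     (\<forall>i j. 2 * (y $ i $ j + y $ i $ (j + 1) + y $ (i + 1) $ j + y $ (i + 1) $ (j + 1)) = 2 * h)"
    unfolding franklin8_def using full by blast
  then show ?thesis
    unfolding half bent unfolding double franklin_sums_def conj_assoc .
qed

text \<open>Entries are halves of integer expressions in the parameters, so doubling them keeps the
  linear algebra over the integers.\<close>

lemma franklin8_iff:
  "franklin8 (2 * h) y \<longleftrightarrow> franklin_sums (2 * int h) (\<lambda>i j. 2 * int (y $ i $ j))"
proof -
  have double: "m = n \<longleftrightarrow> 2 * int m = 2 * int n" for m n
    by simp
  show ?thesis
    unfolding franklin8_iff_nat franklin_sums_def
    by (simp only: double of_nat_add distrib_left of_nat_mult of_nat_numeral)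
qed

lemma franklin_sumsD:
  assumes "franklin_sums s e"
  shows "e i 1 + e i 2 + e i 3 + e i 4 = s" "e i 5 + e i 6 + e i 7 + e i 8 = s"
    "e 1 i + e 2 i + e 3 i + e 4 i = s" "e 5 i + e 6 i + e 7 i + e 8 i = s"
    "e i j + e i (j + 1) + e (i + 1) j + e (i + 1) (j + 1) = s"
    "e 1 1 + e 2 2 + e 3 3 + e 4 4 + e 4 5 + e 3 6 + e 2 7 + e 1 8 = 2 * s"
    "e 1 1 + e 2 2 + e 3 3 + e 4 4 + e 5 4 + e 6 3 + e 7 2 + e 8 1 = 2 * s"
  using assms unfolding franklin_sums_def by (metis add_0)+

section \<open>Nine linear coordinates determine a solution\<close>

lemma cyclic_induct:
  fixes i k :: 8
  assumes base: "P k" and step: "\<And>i. P i \<Longrightarrow> P (i + 1)"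
  shows "P i"
proof -
  have nine: "(9::8) = 1"
    by simp
  have "P 1 \<longrightarrow> P 2" "P 2 \<longrightarrow> P 3" "P 3 \<longrightarrow> P 4" "P 4 \<longrightarrow> P 5" "P 5 \<longrightarrow> P 6" "P 6 \<longrightarrow> P 7" "P 7 \<longrightarrow> P 8" "P 8 \<longrightarrow> P 1"
    using step[of 1] step[of 2] step[of 3] step[of 4] step[of 5] step[of 6] step[of 7] step[of 8]
    by (simp_all add: nine)
  then have "\<forall>k. P k \<longrightarrow> (\<forall>i. P i)"
    unfolding all_8 by blast
  then show ?thesis
    using base by blast
qed

text \<open>The difference \<open>z\<close> of two solutions solves the homogeneous system with all
  nine coordinates zero. Its first row and first column vanish, and the 2 by 2 equations then force
  the rest to vanish.\<close>

lemma franklin_sums_eqI: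
  fixes e f :: "8 \<Rightarrow> 8 \<Rightarrow> int"
  assumes e: "franklin_sums s e" and f: "franklin_sums s f"
    and param: "e 1 1 + e 3 3 = f 1 1 + f 3 3"
    and row: "e 1 1 - e 3 1 = f 1 1 - f 3 1" "e 2 2 - e 4 2 = f 2 2 - f 4 2"
      "e 5 5 - e 7 5 = f 5 5 - f 7 5" "e 6 6 - e 8 6 = f 6 6 - f 8 6"
    and column: "e 1 1 - e 1 3 = f 1 1 - f 1 3" "e 2 2 - e 2 4 = f 2 2 - f 2 4"
      "e 5 5 - e 5 7 = f 5 5 - f 5 7" "e 6 6 - e 6 8 = f 6 6 - f 6 8"
  shows "e i j = f i j"
proof -
  define z where "z i j = e i j - f i j" for i j
  have sq: "z i j + z i (j + 1) + z (i + 1) j + z (i + 1) (j + 1) = 0" for i j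
    using franklin_sumsD(5)[OF e, of i j] franklin_sumsD(5)[OF f, of i j] by (simp add: z_def)
  have half_row: "z i 1 + z i 2 + z i 3 + z i 4 = 0" "z i 5 + z i 6 + z i 7 + z i 8 = 0" for i
    using franklin_sumsD(1,2)[OF e, of i] franklin_sumsD(1,2)[OF f, of i] by (simp_all add: z_def)
  have half_column: "z 1 j + z 2 j + z 3 j + z 4 j = 0" "z 5 j + z 6 j + z 7 j + z 8 j = 0" for j
    using franklin_sumsD(3,4)[OF e, of j] franklin_sumsD(3,4)[OF f, of j] by (simp_all add: z_def)
  have bent: "z 1 1 + z 2 2 + z 3 3 + z 4 4 + z 4 5 + z 3 6 + z 2 7 + z 1 8 = 0"
      "z 1 1 + z 2 2 + z 3 3 + z 4 4 + z 5 4 + z 6 3 + z 7 2 + z 8 1 = 0"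
    using franklin_sumsD(6,7)[OF e] franklin_sumsD(6,7)[OF f] by (simp_all add: z_def)
  \<comment> \<open>Subtracting two vertically adjacent 2 by 2 equations shows that rows
    \<open>i\<close> and \<open>i + 2\<close> have the same sums over columns \<open>j\<close> and
    \<open>j + 1\<close>; so agreement in one column passes to the next, around the torus.\<close>
  have row_step: "z i (j + 1) = z (i + 2) (j + 1)" if "z i j = z (i + 2) j" for i j
    using sq[of i j] sq[of "i + 1" j] that by (simp add: add.assoc)
  have column_step: "z (i + 1) j = z (i + 1) (j + 2)" if "z i j = z i (j + 2)" for i j
    using sq[of i j] sq[of i "j + 1"] that by (simp add: add.assoc)
  have rows: "z 1 j = z 3 j" "z 2 j = z 4 j" "z 5 j = z 7 j" "z 6 j = z 8 j" for j
    using row cyclic_induct[of "\<lambda>j. z 1 j = z (1 + 2) j" 1 j] cyclic_induct[of "\<lambda>j. z 2 j = z (2 + 2) j" 2 j]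
      cyclic_induct[of "\<lambda>j. z 5 j = z (5 + 2) j" 5 j] cyclic_induct[of "\<lambda>j. z 6 j = z (6 + 2) j" 6 j] row_step
    by (simp_all add: z_def)
  have columns: "z i 1 = z i 3" "z i 2 = z i 4" "z i 5 = z i 7" "z i 6 = z i 8" for i
    using column cyclic_induct[of "\<lambda>i. z i 1 = z i (1 + 2)" 1 i] cyclic_induct[of "\<lambda>i. z i 2 = z i (2 + 2)" 2 i]
      cyclic_induct[of "\<lambda>i. z i 5 = z i (5 + 2)" 5 i] cyclic_induct[of "\<lambda>i. z i 6 = z i (6 + 2)" 6 i] column_step
    by (simp_all add: z_def)
  \<comment> \<open>With equal paired rows the half-column sum is
    \<open>2 * (z 1 j + z 2 j)\<close>.\<close>
  have row2: "z 2 j = - z 1 j" for j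
    using half_column[of j] rows[of j] by linarith
  have column2: "z i 2 = - z i 1" "z i 6 = - z i 5" for i
    using half_row[of i] columns[of i] by linarith+
  have row6: "z 6 j = - z 5 j" for j
    using half_column[of j] rows[of j] by linarith
  have "z 1 1 + z 3 3 = 0"
    using param by (simp add: z_def)
  then have z11: "z 1 1 = 0"
    using rows(1)[of 3] columns(1)[of 1] by linarith
  \<comment> \<open>By the row and column relations the bent diagonal sum reduces to
    \<open>- 4 * z 1 5\<close>.\<close>
  have "z 1 5 = 0"
    using bent(1) z11 rows(1)[of 3] rows(1)[of 6] rows(2)[of 4] rows(2)[of 5] columns(1)[of 1] columns(4)[of 1]
      columns(2)[of 2] columns(3)[of 2] column2(1)[of 1] column2(1)[of 2] column2(2)[of 1] row2[of 1] row2[of 5]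
      row2[of 2]
    by linarith
  then have row1: "z 1 j = 0" for j
    using z11 columns[of 1] column2[of 1] all_8[of "\<lambda>j. z 1 j = 0"] by auto
  have "z 5 1 = 0"
    using bent(2) z11 columns(1)[of 3] columns(1)[of 6] columns(2)[of 4] columns(2)[of 5] rows(1)[of 1] rows(4)[of 1]
      rows(2)[of 2] rows(3)[of 2] row2[of 1] row2[of 2] row6[of 1] column2(1)[of 1] column2(1)[of 5] column2(1)[of 2]
    by linarith
  then have column1: "z i 1 = 0" for i
    using z11 rows[of 1] row2[of 1] row6[of 1] all_8[of "\<lambda>i. z i 1 = 0"] by auto
  have "\<forall>j. z i j = 0"
  proof (rule cyclic_induct[where k = 1])
    fix i assume i: "\<forall>j. z i j = 0"
    have "z (i + 1) j = 0" for j
    proof (rule cyclic_induct[where k = 1])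
      fix j assume "z (i + 1) j = 0"
      then show "z (i + 1) (j + 1) = 0"
        using sq[of i j] i by simp
    qed (rule column1)
    then show "\<forall>j. z (i + 1) j = 0" ..
  qed (simp add: row1)
  then show ?thesis
    by (simp add: z_def)
qed

section \<open>The explicit family of solutions\<close>

definition odd_line :: "8 \<Rightarrow> bool" where
  "odd_line i \<longleftrightarrow> i \<in> {1, 3, 5, 7}"

definition offset :: "int \<times> int \<Rightarrow> int \<times> int \<Rightarrow> 8 \<Rightarrow> int" where
  "offset a b i =
    (if i = 1 then fst a else if i = 2 then fst b else if i = 3 then - fst a
     else if i = 4 then - fst b else if i = 5 then snd a else if i = 6 then snd b
     else if i = 7 then - snd a else - snd b)"

definition twice_entry ::
    "int \<Rightarrow> int \<Rightarrow> int \<times> int \<Rightarrow> int \<times> int \<Rightarrow> int \<times> int \<Rightarrow> int \<times> int \<Rightarrow> 8 \<Rightarrow> 8 \<Rightarrow> int" where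
  "twice_entry p q a b c d i j =
    (if odd_line i = odd_line j then p + offset a b i + offset c d j
     else q - offset a b i - offset c d j)"

text \<open>In a 2 by 2 block each row and column offset occurs with both signs. In half-lines the
  paired lines cancel. The two halves of a bent diagonal meet the same lines in opposite
  checkerboard colours, so those offsets cancel between the halves and the others within each
  half.\<close>

lemma franklin_sums_twice_entry: "franklin_sums (2 * (p + q)) (twice_entry p q a b c d)"
  unfolding franklin_sums_def all_8 twice_entry_def
  by (simp add: odd_line_def offset_def)

lemma twice_entry_complete:
  fixes e :: "8 \<Rightarrow> 8 \<Rightarrow> int"
  assumes "franklin_sums (2 * (p + q)) (\<lambda>i j. 2 * e i j)" and "p = e 1 1 + e 3 3"
  shows "2 * e i j = twice_entry p q
    (e 1 1 - e 3 1, e 5 5 - e 7 5) (e 2 2 - e 4 2, e 6 6 - e 8 6)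
    (e 1 1 - e 1 3, e 5 5 - e 5 7) (e 2 2 - e 2 4, e 6 6 - e 6 8) i j"
  by (rule franklin_sums_eqI[OF assms(1) franklin_sums_twice_entry])
    (simp_all add: twice_entry_def odd_line_def offset_def assms(2))

section \<open>Counting the parameters\<close>

text \<open>The argument is an integer so that \<open>level (int a - 2)\<close> is empty for
  \<open>a < 2\<close>.\<close>

definition level :: "int \<Rightarrow> int set" where
  "level m = {x. \<bar>x\<bar> \<le> m \<and> even (x + m)}"

lemma level_eq_image: "level m = (\<lambda>k. 2 * k - m) ` {0..m}"
proof (intro equalityI subsetI)
  fix x assume "x \<in> level m"
  then show "x \<in> (\<lambda>k. 2 * k - m) ` {0..m}"
    by (intro image_eqI[where x = "(x + m) div 2"]) (auto simp: level_def)
qed (auto simp: level_def)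

lemma finite_level: "finite (level m)"
  by (simp add: level_eq_image)

lemma card_level: "card (level m) = nat (m + 1)"
  unfolding level_eq_image by (subst card_image) (auto simp: inj_on_def)

lemma card_level_int: "card (level (int n)) = n + 1"
  by (simp add: card_level nat_add_distrib)

definition radius_pairs :: "nat \<Rightarrow> (int \<times> int) set" where
  "radius_pairs a = {(x, y). max \<bar>x\<bar> \<bar>y\<bar> = int a \<and> even (x - y)}"

text \<open>One of the two absolute values equals \<open>a\<close>, so both components have the
  parity of \<open>a\<close>; within that parity a maximum below \<open>a\<close> is at most
  \<open>a - 2\<close>.\<close>

lemma radius_pairs_eq:
  "radius_pairs a = level (int a) \<times> level (int a) - level (int a - 2) \<times> level (int a - 2)"
proof -
  have "max \<bar>x\<bar> \<bar>y\<bar> = int a \<and> even (x - y) \<longleftrightarrow>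
      (\<bar>x\<bar> \<le> int a \<and> even (x + int a)) \<and> (\<bar>y\<bar> \<le> int a \<and> even (y + int a)) \<and>
      \<not> (\<bar>x\<bar> \<le> int a - 2 \<and> \<bar>y\<bar> \<le> int a - 2)" for x y
    by presburger
  then show ?thesis
    by (auto simp: radius_pairs_def level_def)
qed

lemma finite_radius_pairs: "finite (radius_pairs a)"
  by (simp add: radius_pairs_eq finite_level)

lemma card_radius_pairs: "card (radius_pairs a) = radius_weight a"
proof -
  have "level (int a - 2) \<subseteq> level (int a)"
    by (auto simp: level_def)
  then have "card (radius_pairs a) = (a + 1)\<^sup>2 - (nat (int a - 1))\<^sup>2"
    unfolding radius_pairs_eq
    by (subst card_Diff_subset) (auto simp: finite_level card_cartesian_product card_level power2_eq_square nat_add_distrib)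
  also have "\<dots> = radius_weight a"
    by (cases a) (auto simp: radius_weight_def power2_eq_square)
  finally show ?thesis .
qed

text \<open>The radii are recorded explicitly because the size of a fibre depends only on them and
  on \<open>p\<close>.\<close>

definition parameters where
  "parameters h = (SIGMA (p, \<alpha>, \<beta>):radii h. radius_pairs \<alpha> \<times> radius_pairs \<beta> \<times>
      (level (int (min (p - \<alpha>) (h - p - \<beta>))) \<times> level (int (min (p - \<alpha>) (h - p - \<beta>)))) \<times>
      (level (int (min (p - \<beta>) (h - p - \<alpha>))) \<times> level (int (min (p - \<beta>) (h - p - \<alpha>)))))"

lemma finite_radii: "finite (radii h)"
  by (rule finite_subset[of _ "{..h} \<times> {..h} \<times> {..h}"]) (auto simp: radii_def)

lemma card_parameters: "card (parameters h) = (\<Sum>z\<in>slacks h. slack_weight z)"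
proof -
  have "card (parameters h) =
    (\<Sum>(p, a, b)\<in>radii h. radius_weight a * radius_weight b *
      (min (p - a) (h - p - b) + 1)\<^sup>2 * (min (p - b) (h - p - a) + 1)\<^sup>2)"
    unfolding parameters_def
    by (subst card_SigmaI)
      (auto simp: finite_radii finite_radius_pairs finite_level card_cartesian_product card_radius_pairs
        card_level_int power2_eq_square algebra_simps simp del: of_nat_min intro!: sum.cong)
  then show ?thesis
    unfolding sum_radii .
qed

text \<open>Every combination of signs and components occurs in some cell, so the worst case is a
  sum of maximal absolute values.\<close>

lemma twice_entry_nonneg_iff:
  "(\<forall>i j. 0 \<le> twice_entry p q (a1, a2) (b1, b2) (c1, c2) (d1, d2) i j) \<longleftrightarrow>
    max \<bar>a1\<bar> \<bar>a2\<bar> + max \<bar>c1\<bar> \<bar>c2\<bar> \<le> p \<and> max \<bar>b1\<bar> \<bar>b2\<bar> + max \<bar>d1\<bar> \<bar>d2\<bar> \<le> p \<and>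
    max \<bar>a1\<bar> \<bar>a2\<bar> + max \<bar>d1\<bar> \<bar>d2\<bar> \<le> q \<and> max \<bar>b1\<bar> \<bar>b2\<bar> + max \<bar>c1\<bar> \<bar>c2\<bar> \<le> q"
proof -
  have max: "max x y + max z w \<le> r \<longleftrightarrow> x + z \<le> r \<and> x + w \<le> r \<and> y + z \<le> r \<and> y + w \<le> r" for x y z w r :: int
    by linarith
  have abs: "\<bar>x\<bar> + \<bar>z\<bar> \<le> r \<longleftrightarrow> 0 \<le> r + x + z \<and> 0 \<le> r + x - z \<and> 0 \<le> r - x + z \<and> 0 \<le> r - x - z" for x z r :: int
    by linarith
  show ?thesis
    unfolding max abs all_8 twice_entry_def
    by (simp add: odd_line_def offset_def) blast
qed

lemma twice_entry_even_iff:
  "(\<forall>i j. even (twice_entry p q (a1, a2) (b1, b2) (c1, c2) (d1, d2) i j)) \<longleftrightarrow>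
    even (a1 - a2) \<and> even (b1 - b2) \<and> even (c1 - c2) \<and> even (d1 - d2) \<and>
    even (p + a1 + c1) \<and> even (p + b1 + d1) \<and> even (q + a1 + d1) \<and> even (q + b1 + c1)"
  unfolding all_8 twice_entry_def
  by (simp add: odd_line_def offset_def) blast

text \<open>The two arguments of the minimum add up to \<open>h - a - b\<close>, which is even, so
  they have equal parity.\<close>

lemma even_min:
  fixes a b p h :: nat
  assumes "a \<le> p" "b \<le> h - p" "p \<le> h" "even (a + b + h)"
  shows "even (min (p - a) (h - p - b)) \<longleftrightarrow> even (p + a)"
proof -
  obtain x where x: "p = a + x"
    using assms(1) le_iff_add by blast
  obtain y where y: "h = p + b + y"
    using assms(2,3) by (metis add.assoc le_add_diff_inverse)
  have "even x \<longleftrightarrow> even y"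
    using assms(4) unfolding x y by auto
  then show ?thesis
    unfolding x y by (auto simp: min_def)
qed

text \<open>Identifies the combinatorial description used for counting with the requirement that all
  doubled entries be even and nonnegative.\<close>

lemma mem_parameters_iff:
  "((p, \<alpha>, \<beta>), (a1, a2), (b1, b2), (c1, c2), (d1, d2)) \<in> parameters h \<longleftrightarrow>
    p \<le> h \<and> int \<alpha> = max \<bar>a1\<bar> \<bar>a2\<bar> \<and> int \<beta> = max \<bar>b1\<bar> \<bar>b2\<bar> \<and>
    (\<forall>i j. 0 \<le> twice_entry (int p) (int (h - p)) (a1, a2) (b1, b2) (c1, c2) (d1, d2) i j) \<and>
    (\<forall>i j. even (twice_entry (int p) (int (h - p)) (a1, a2) (b1, b2) (c1, c2) (d1, d2) i j))"
    (is "?L \<longleftrightarrow> ?R")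
proof -
  let ?m = "min (p - \<alpha>) (h - p - \<beta>)" and ?n = "min (p - \<beta>) (h - p - \<alpha>)"
  have L: "?L \<longleftrightarrow> (p \<le> h \<and> \<alpha> \<le> p \<and> \<alpha> \<le> h - p \<and> \<beta> \<le> p \<and> \<beta> \<le> h - p \<and> even (\<alpha> + \<beta> + h)) \<and>
      max \<bar>a1\<bar> \<bar>a2\<bar> = int \<alpha> \<and> even (a1 - a2) \<and> max \<bar>b1\<bar> \<bar>b2\<bar> = int \<beta> \<and> even (b1 - b2) \<and>
      \<bar>c1\<bar> \<le> int ?m \<and> \<bar>c2\<bar> \<le> int ?m \<and> even (c1 + int ?m) \<and> even (c2 + int ?m) \<and>
      \<bar>d1\<bar> \<le> int ?n \<and> \<bar>d2\<bar> \<le> int ?n \<and> even (d1 + int ?n) \<and> even (d2 + int ?n)"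
    unfolding parameters_def radii_def radius_pairs_def level_def mem_Sigma_iff mem_Collect_eq prod.case
      min.bounded_iff
    by (intro iffI; elim conjE; intro conjI; assumption)
  have max_even: "even x \<longleftrightarrow> even y" if "x = max \<bar>y\<bar> \<bar>z\<bar>" "even (y - z)" for x y z :: int
    using that by (auto simp: max_def)
  \<comment> \<open>The order conditions make the truncated subtractions exact.\<close>
  have transfer: "x \<le> int (m - n) \<longleftrightarrow> int n + x \<le> int m" if "n \<le> m" for x m n
    using that by auto
  have "?L \<longleftrightarrow> (p \<le> h \<and> \<alpha> \<le> p \<and> \<alpha> \<le> h - p \<and> \<beta> \<le> p \<and> \<beta> \<le> h - p \<and> even (\<alpha> + \<beta> + h)) \<and>
      (max \<bar>a1\<bar> \<bar>a2\<bar> = int \<alpha> \<and> even (a1 - a2) \<and> max \<bar>b1\<bar> \<bar>b2\<bar> = int \<beta> \<and> even (b1 - b2)) \<and>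
      (int \<alpha> + max \<bar>c1\<bar> \<bar>c2\<bar> \<le> int p \<and> int \<beta> + max \<bar>d1\<bar> \<bar>d2\<bar> \<le> int p \<and>
       int \<alpha> + max \<bar>d1\<bar> \<bar>d2\<bar> \<le> int (h - p) \<and> int \<beta> + max \<bar>c1\<bar> \<bar>c2\<bar> \<le> int (h - p)) \<and>
      (even (c1 + int ?m) \<and> even (c2 + int ?m) \<and> even (d1 + int ?n) \<and> even (d2 + int ?n))"
    (is "_ \<longleftrightarrow> ?order \<and> ?radius \<and> ?bound \<and> ?parity")
  proof (cases ?order)
    case True
    then have "?bound \<longleftrightarrow> \<bar>c1\<bar> \<le> int ?m \<and> \<bar>c2\<bar> \<le> int ?m \<and> \<bar>d1\<bar> \<le> int ?n \<and> \<bar>d2\<bar> \<le> int ?n"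
      unfolding of_nat_min min.bounded_iff by (subst (1 2 3 4 5 6 7 8) transfer) (auto simp only: max_add_distrib_right max.bounded_iff)
    then show ?thesis
      unfolding L by blast
  qed (use L in blast)
  also have "\<dots> \<longleftrightarrow> ?R"
  proof -
    have nonneg: "0 \<le> max \<bar>x\<bar> \<bar>y\<bar>" for x y :: int
      by (simp add: le_max_iff_disj)
    have le: "m \<le> n" if "int m + x \<le> int n" "0 \<le> x" for m n x
      using that by linarith
    have order: "\<alpha> \<le> p \<and> \<alpha> \<le> h - p \<and> \<beta> \<le> p \<and> \<beta> \<le> h - p" if ?bound
      using that le[OF _ nonneg] by blast
    \<comment> \<open>A radius has the parity of its components, and by \<open>even_min\<close> the
      bounds have the parity of \<open>p + \<alpha>\<close> and \<open>p + \<beta>\<close>.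
      Conversely, adding the conditions on \<open>p + a1 + c1\<close> and \<open>q + b1 + c1\<close>
      shows that \<open>\<alpha> + \<beta> + h\<close> is even.\<close>
    have parity: "even (\<alpha> + \<beta> + h) \<and> ?parity \<longleftrightarrow> even (c1 - c2) \<and> even (d1 - d2) \<and>
        even (int p + a1 + c1) \<and> even (int p + b1 + d1) \<and>
        even (int (h - p) + a1 + d1) \<and> even (int (h - p) + b1 + c1)"
      if ?radius "p \<le> h" "\<alpha> \<le> p \<and> \<alpha> \<le> h - p \<and> \<beta> \<le> p \<and> \<beta> \<le> h - p"
    proof -
      have "even \<alpha> \<longleftrightarrow> even a1" "even \<beta> \<longleftrightarrow> even b1"
        using max_even[of "int \<alpha>" a1 a2] max_even[of "int \<beta>" b1 b2] \<open>?radius\<close> by simp_all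
      moreover have "even ?m \<longleftrightarrow> even (p + \<alpha>)" "even ?n \<longleftrightarrow> even (p + \<beta>)" if "even (\<alpha> + \<beta> + h)"
        using even_min[of \<alpha> p \<beta> h] even_min[of \<beta> p \<alpha> h] \<open>p \<le> h\<close> that
          \<open>\<alpha> \<le> p \<and> \<alpha> \<le> h - p \<and> \<beta> \<le> p \<and> \<beta> \<le> h - p\<close> by (simp_all only: add.commute[of \<beta> \<alpha>])
      moreover have "even (h - p) \<longleftrightarrow> even (h + p)"
        using \<open>p \<le> h\<close> by simp
      ultimately show ?thesis
        unfolding even_add even_diff even_of_nat by argo
    qed
    show ?thesis
      unfolding twice_entry_nonneg_iff twice_entry_even_iff
      using order parity by (metis (no_types, lifting))
  qed
  finally show ?thesis .
qed

section \<open>The bijection between parameters and squares\<close>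

definition square_of where
  "square_of h = (\<lambda>((p :: nat, \<alpha> :: nat, \<beta> :: nat), a, b, c, d).
     (\<chi> i j. nat (twice_entry (int p) (int (h - p)) a b c d i j div 2)) :: square8)"

definition parameters_of where
  "parameters_of (y :: square8) =
     (let e = \<lambda>i j. int (y $ i $ j);
          a = (e 1 1 - e 3 1, e 5 5 - e 7 5); b = (e 2 2 - e 4 2, e 6 6 - e 8 6);
          c = (e 1 1 - e 1 3, e 5 5 - e 5 7); d = (e 2 2 - e 2 4, e 6 6 - e 6 8)
      in ((y $ 1 $ 1 + y $ 3 $ 3, nat (max \<bar>fst a\<bar> \<bar>snd a\<bar>), nat (max \<bar>fst b\<bar> \<bar>snd b\<bar>)), a, b, c, d))"

text \<open>Membership makes the doubled entries even and nonnegative, so neither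
  \<open>div 2\<close> nor \<open>nat\<close> loses information.\<close>

lemma square_of_entry:
  assumes "((p, \<alpha>, \<beta>), a, b, c, d) \<in> parameters h"
  shows "2 * int (square_of h ((p, \<alpha>, \<beta>), a, b, c, d) $ i $ j) = twice_entry (int p) (int (h - p)) a b c d i j"
  using assms mem_parameters_iff[of p \<alpha> \<beta> "fst a" "snd a" "fst b" "snd b" "fst c" "snd c" "fst d" "snd d" h]
  by (simp add: square_of_def del: of_nat_diff)

lemma parameters_of_square_of:
  assumes "t \<in> parameters h"
  shows "parameters_of (square_of h t) = t"
proof -
  obtain p \<alpha> \<beta> a1 a2 b1 b2 c1 c2 d1 d2 where t: "t = ((p, \<alpha>, \<beta>), (a1, a2), (b1, b2), (c1, c2), (d1, d2))"
    by (metis prod.exhaust)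
  note mem = assms[unfolded t]
  have radius: "nat (max \<bar>a1\<bar> \<bar>a2\<bar>) = \<alpha>" "nat (max \<bar>b1\<bar> \<bar>b2\<bar>) = \<beta>"
    using mem[unfolded mem_parameters_iff] by linarith+
  let ?e = "\<lambda>i j. int (square_of h t $ i $ j)"
  note e = square_of_entry[OF mem, folded t, unfolded twice_entry_def]
  have "?e 1 1 + ?e 3 3 = int p"
    using e[of 1 1] e[of 3 3] by (simp add: odd_line_def offset_def)
  then have p: "square_of h t $ 1 $ 1 + square_of h t $ 3 $ 3 = p"
    by linarith
  have diffs: "?e 1 1 - ?e 3 1 = a1" "?e 5 5 - ?e 7 5 = a2" "?e 2 2 - ?e 4 2 = b1" "?e 6 6 - ?e 8 6 = b2"
    "?e 1 1 - ?e 1 3 = c1" "?e 5 5 - ?e 5 7 = c2" "?e 2 2 - ?e 2 4 = d1" "?e 6 6 - ?e 6 8 = d2"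
    using e[of 1 1] e[of 3 1] e[of 5 5] e[of 7 5] e[of 2 2] e[of 4 2] e[of 6 6] e[of 8 6]
      e[of 1 3] e[of 5 7] e[of 2 4] e[of 6 8]
    by (simp_all add: odd_line_def offset_def)
  show ?thesis
    unfolding parameters_of_def Let_def diffs p radius fst_conv snd_conv by (simp only: t)
qed

lemma franklin8_square_of:
  assumes "t \<in> parameters h"
  shows "franklin8 (2 * h) (square_of h t)"
proof -
  obtain p \<alpha> \<beta> a b c d where t: "t = ((p, \<alpha>, \<beta>), a, b, c, d)"
    by (metis prod.exhaust)
  have "p \<le> h"
    using assms unfolding t parameters_def radii_def by simp
  then show ?thesis
    using franklin_sums_twice_entry[of "int p" "int (h - p)" a b c d]
    by (simp add: franklin8_iff square_of_entry[OF assms[unfolded t]] t)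
qed

lemma franklin8_parameters_of:
  assumes "franklin8 (2 * h) y"
  shows "parameters_of y \<in> parameters h" "square_of h (parameters_of y) = y"
proof -
  let ?e = "\<lambda>i j. int (y $ i $ j)"
  define p where "p = y $ 1 $ 1 + y $ 3 $ 3"
  define a1 where "a1 = ?e 1 1 - ?e 3 1"
  define a2 where "a2 = ?e 5 5 - ?e 7 5"
  define b1 where "b1 = ?e 2 2 - ?e 4 2"
  define b2 where "b2 = ?e 6 6 - ?e 8 6"
  define c1 where "c1 = ?e 1 1 - ?e 1 3"
  define c2 where "c2 = ?e 5 5 - ?e 5 7"
  define d1 where "d1 = ?e 2 2 - ?e 2 4"
  define d2 where "d2 = ?e 6 6 - ?e 6 8"
  define \<alpha> where "\<alpha> = nat (max \<bar>a1\<bar> \<bar>a2\<bar>)"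
  define \<beta> where "\<beta> = nat (max \<bar>b1\<bar> \<bar>b2\<bar>)"
  have t: "parameters_of y = ((p, \<alpha>, \<beta>), (a1, a2), (b1, b2), (c1, c2), (d1, d2))"
    by (simp add: parameters_of_def Let_def p_def a1_def a2_def b1_def b2_def c1_def c2_def d1_def d2_def
        \<alpha>_def \<beta>_def)
  have "p \<le> h"
  proof -
    have row: "y $ i $ 1 + y $ i $ 3 \<le> h"
      and square: "y $ i $ j + y $ i $ (j + 1) + y $ (i + 1) $ j + y $ (i + 1) $ (j + 1) = h" for i j
      using franklin_sumsD(1,5)[OF assms[unfolded franklin8_iff_nat], of i] by (simp_all flip: add.assoc)
    \<comment> \<open>This is the alternating sum of the four 2 by 2 conditions inside rows and
      columns 1 to 3. With the row bounds it gives \<open>2 * p \<le> 2 * h\<close>, so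
      \<open>h - p\<close> is the true \<open>q\<close>.\<close>
    have "y $ 1 $ 1 + y $ 3 $ 3 = y $ 1 $ 3 + y $ 3 $ 1"
      using square[of 1 1] square[of 1 2] square[of 2 1] square[of 2 2] by simp
    then show ?thesis
      using row[of 1] row[of 3] by (simp add: p_def)
  qed
  then have "franklin_sums (2 * (int p + int (h - p))) (\<lambda>i j. 2 * ?e i j)"
    using assms by (simp add: franklin8_iff)
  from twice_entry_complete[OF this]
  have e: "2 * ?e i j = twice_entry (int p) (int (h - p)) (a1, a2) (b1, b2) (c1, c2) (d1, d2) i j" for i j
    by (simp add: p_def a1_def a2_def b1_def b2_def c1_def c2_def d1_def d2_def)
  show "parameters_of y \<in> parameters h"
    unfolding t mem_parameters_iff e[symmetric] using \<open>p \<le> h\<close> by (simp add: \<alpha>_def \<beta>_def le_max_iff_disj)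
  show "square_of h (parameters_of y) = y"
    by (simp add: t square_of_def vec_eq_iff flip: e)
qed

lemma F8_eq: "F8 (2 * h) = (\<Sum>z\<in>slacks h. slack_weight z)"
proof -
  have "bij_betw (square_of h) (parameters h) {y. franklin8 (2 * h) y}"
    by (rule bij_betw_byWitness[where f' = parameters_of])
      (auto simp: parameters_of_square_of franklin8_square_of franklin8_parameters_of)
  then show ?thesis
    unfolding F8_def card_parameters[symmetric] by (simp add: bij_betw_same_card)
qed

section \<open>The enumeration\<close>

lemma F8_odd: "odd s \<Longrightarrow> F8 s = 0"
proof -
  assume "odd s"
  have "\<not> franklin8 s y" for y
  proof
    assume "franklin8 s y"
    then have "2 * (\<Sum>j\<in>{1, 2, 3, 4}. y $ 1 $ j) = s"
      unfolding franklin8_def halves_def by blast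
    then show False
      using \<open>odd s\<close> by (metis dvd_triv_left)
  qed
  then show ?thesis
    by (simp add: F8_def)
qed

text \<open>Here \<open>h = 1\<close>, the one odd value not of the form \<open>3 + 2 * n\<close>,
  so the summation formula does not reach it.\<close>

lemma F8_2: "F8 2 = 0"
proof -
  have "slacks 1 = {}"
  proof -
    have False if "even (d + e)" "2 * u + 2 * v + 2 * e + d = 1" for d e u v :: nat
    proof -
      have "e = 0"
        using that(2) by linarith
      then show False
        using that by presburger
    qed
    then show ?thesis
      unfolding slacks_def by blast
  qed
  then show ?thesis
    using F8_eq[of 1] by simp
qed

lemma F8_eq_total_sum: "F8 (4 * n) = total_sum n 0" "F8 (4 * n + 6) = total_sum n 1"
  using F8_eq[of "2 * n"] F8_eq[of "2 * n + 3"] sum_slacks[of 0 n] sum_slacks[of 1 n]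
  by (simp_all add: ac_simps)

theorem theorem1p4p3:
  fixes s :: nat
  shows "real (F8 s) =
    (if s mod 12 = 2 \<and> s \<noteq> 2 then
        23 / 627056640 * real s ^ 9 + 23 / 17418240 * real s ^ 8 + 167 / 6531840 * real s ^ 7 + 5 / 15552 * real s ^ 6
          + 2419 / 933120 * real s ^ 5 + 1013 / 77760 * real s ^ 4 + 701 / 22680 * real s ^ 3
          - 359 / 10206 * real s ^ 2 - 177967 / 816480 * real s + 241 / 17496
     else if s mod 12 = 4 then
        23 / 627056640 * real s ^ 9 + 23 / 17418240 * real s ^ 8 + 167 / 6531840 * real s ^ 7 + 5 / 15552 * real s ^ 6
          + 581 / 186624 * real s ^ 5 + 1823 / 77760 * real s ^ 4 + 6127 / 45360 * real s ^ 3
          + 10741 / 20412 * real s ^ 2 + 113443 / 102060 * real s + 3211 / 2187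
     else if s mod 12 = 6 then
        23 / 627056640 * real s ^ 9 + 23 / 17418240 * real s ^ 8 + 167 / 6531840 * real s ^ 7 + 5 / 15552 * real s ^ 6
          + 2419 / 933120 * real s ^ 5 + 1013 / 77760 * real s ^ 4 + 701 / 22680 * real s ^ 3
          - 5 / 378 * real s ^ 2 - 3967 / 10080 * real s - 13 / 8
     else if s mod 12 = 8 then
        23 / 627056640 * real s ^ 9 + 23 / 17418240 * real s ^ 8 + 167 / 6531840 * real s ^ 7 + 5 / 15552 * real s ^ 6
          + 581 / 186624 * real s ^ 5 + 1823 / 77760 * real s ^ 4 + 6127 / 45360 * real s ^ 3
          + 11189 / 20412 * real s ^ 2 + 167203 / 102060 * real s + 5771 / 2187
     else if s mod 12 = 10 then
        23 / 627056640 * real s ^ 9 + 23 / 17418240 * real s ^ 8 + 167 / 6531840 * real s ^ 7 + 5 / 15552 * real s ^ 6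
          + 2419 / 933120 * real s ^ 5 + 1013 / 77760 * real s ^ 4 + 701 / 22680 * real s ^ 3
          - 583 / 10206 * real s ^ 2 - 608047 / 816480 * real s - 20239 / 17496
     else if s mod 12 = 0 then
        23 / 627056640 * real s ^ 9 + 23 / 17418240 * real s ^ 8 + 167 / 6531840 * real s ^ 7 + 5 / 15552 * real s ^ 6
          + 581 / 186624 * real s ^ 5 + 1823 / 77760 * real s ^ 4 + 6127 / 45360 * real s ^ 3
          + 431 / 756 * real s ^ 2 + 1843 / 1260 * real s + 1
     else 0)"
proof -
  define m where "m = s div 12"
  have quarter: "F8 (12 * m + 4 * r) = total_sum (3 * m + r) 0" and shifted: "F8 (12 * m + 4 * r + 6) = total_sum (3 * m + r) 1" for m r
    using F8_eq_total_sum[of "3 * m + r"] by (simp_all add: algebra_simps)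
  consider "odd s" | "s = 2" | k where "s = 12 * k + 14" | "s = 12 * m + 4" | "s = 12 * m + 6"
    | "s = 12 * m + 8" | "s = 12 * m + 10" | "s = 12 * m"
  proof -
    have s: "s = 12 * m + s mod 12"
      by (simp add: m_def)
    have "odd s \<or> s mod 12 = 0 \<or> s mod 12 = 2 \<or> s mod 12 = 4 \<or> s mod 12 = 6 \<or> s mod 12 = 8 \<or> s mod 12 = 10"
      by presburger
    \<comment> \<open>Apart from 2 itself, residue 2 starts at 14, which is \<open>4 * n + 6\<close>
      with \<open>n = 2\<close>.\<close>
    moreover have "s = 2 \<or> (\<exists>k. s = 12 * k + 14)" if "s mod 12 = 2"
      using that s by (cases m) auto
    ultimately show thesis
      using that s by (metis add_0_right)
  qed
  then show ?thesis
  proof cases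
    case 1
    then have "s mod 12 \<noteq> 2" "s mod 12 \<noteq> 4" "s mod 12 \<noteq> 6" "s mod 12 \<noteq> 8" "s mod 12 \<noteq> 10" "s mod 12 \<noteq> 0"
      by presburger+
    then show ?thesis
      by (simp only: F8_odd[OF 1] simp_thms if_False of_nat_0)
  next
    case 2
    then show ?thesis
      by (simp add: F8_2)
  next
    case (3 k)
    then have "s mod 12 = 2" "s \<noteq> 2" "real s = 12 * real k + 14" "F8 s = total_sum (3 * k + 2) 1"
      using shifted[of k 2] by (simp_all add: add.commute)
    then show ?thesis
      by (simp only: total_sum_1_closed Let_def simp_thms if_True)
  next
    case 4
    then have "s mod 12 = 4" "real s = 12 * real m + 4" "F8 s = total_sum (3 * m + 1) 0"
      using quarter[of m 1] by simp_all
    then show ?thesis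
      by (simp only: total_sum_0_closed Let_def) simp
  next
    case 5
    then have "s mod 12 = 6" "real s = 12 * real m + 6" "F8 s = total_sum (3 * m) 1"
      using shifted[of m 0] by simp_all
    then show ?thesis
      by (simp only: total_sum_1_closed Let_def) simp
  next
    case 6
    then have "s mod 12 = 8" "real s = 12 * real m + 8" "F8 s = total_sum (3 * m + 2) 0"
      using quarter[of m 2] by simp_all
    then show ?thesis
      by (simp only: total_sum_0_closed Let_def) simp
  next
    case 7
    then have "s mod 12 = 10" "real s = 12 * real m + 10" "F8 s = total_sum (3 * m + 1) 1"
      using shifted[of m 1] by (simp_all add: add.commute)
    then show ?thesis
      by (simp only: total_sum_1_closed Let_def) simp
  next
    case 8
    then have "s mod 12 = 0" "real s = 12 * real m" "F8 s = total_sum (3 * m) 0"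
      using quarter[of m 0] by simp_all
    then show ?thesis
      by (simp only: total_sum_0_closed Let_def) simp
  qed
qed

end
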